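(* Let $q$ be a power of $2$, let $\mathbb{F}_q$ be the field with $q$ elements, and let $\mathcal{P}_1$ be the set of monic irreducible polynomials in $\mathbb{F}_q[T]$. For every positive integer $k$ with $k \equiv 0 \pmod{q-1}$, the sum \[ \sum_{P \in \mathcal{P}_1} \frac{1}{P^{k}-1} \] (taken in $\widehat{\mathcal{K}}$) lies in $\mathcal{K} = \mathbb{F}_q(T)$.
   Context: $\mathcal{K}=\mathbb{F}_q(T)$ and $\widehat{\mathcal{K}}$ is its completion with respect to the $T^{-1}$-adic valuation (i.e. $\widehat{\mathcal{K}} = \mathbb{F}_q((T^{-1}))$). Each summand $1/(P^k-1)$ is viewed as an element of $\widehat{\mathcal{K}}$ (a Laurent series in $T^{-1}$), and the infinite sum is understood in the $T^{-1}$-adic topology. *)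

theory Defs
  imports
    "HOL-Analysis.Infinite_Sum"
    "HOL-Computational_Algebra.Computational_Algebra"
    "HOL-Number_Theory.Cong"
begin

text \<open>
  The completion of $F(T)$ at the $T^{-1}$-adic valuation is \<^typ>\<open>'a fls\<close>, with \<^const>\<open>fls_X\<close>
  in the role of $T^{-1}$; thus $T$ itself is \<^const>\<open>fls_X_inv\<close>, and the library metric on
  \<^typ>\<open>'a fls\<close> induces the $T^{-1}$-adic topology.
\<close>

definition poly_to_fls :: "'a::field poly \<Rightarrow> 'a fls" where
  "poly_to_fls p = poly (map_poly fls_const p) fls_X_inv"

lemma poly_to_fls_0 [simp]: "poly_to_fls 0 = 0"
  by (simp add: poly_to_fls_def)

lemma poly_to_fls_pCons:
  "poly_to_fls (pCons a p) = fls_const a + fls_X_inv * poly_to_fls p"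
  by (cases "a = 0 \<and> p = 0") (auto simp: poly_to_fls_def map_poly_pCons)

lemma poly_to_fls_1 [simp]: "poly_to_fls 1 = 1"
  by (simp add: one_pCons poly_to_fls_pCons)

lemma poly_to_fls_T: "poly_to_fls [:0, 1:] = fls_X_inv"
  by (simp add: poly_to_fls_pCons)

lemma poly_to_fls_add: "poly_to_fls (p + q) = poly_to_fls p + poly_to_fls q"
proof (induction p q rule: poly_induct2)
  case (pCons a p b q)
  then show ?case
    by (simp add: poly_to_fls_pCons fls_plus_const [symmetric] algebra_simps)
qed simp

lemma poly_to_fls_smult: "poly_to_fls (smult a p) = fls_const a * poly_to_fls p"
proof (induction p)
  case (pCons b p)
  then show ?case
    by (simp add: poly_to_fls_pCons fls_const_mult_const [symmetric] algebra_simps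
        del: fls_const_mult_const)
qed simp

lemma poly_to_fls_mult: "poly_to_fls (p * q) = poly_to_fls p * poly_to_fls q"
proof (induction p)
  case (pCons a p)
  have "poly_to_fls (pCons a p * q)
      = poly_to_fls (smult a q) + poly_to_fls (pCons 0 (p * q))"
    by (simp add: poly_to_fls_add)
  then show ?case
    using pCons by (simp add: poly_to_fls_smult poly_to_fls_pCons algebra_simps)
qed simp

lemma poly_to_fls_nth:
  "fls_nth (poly_to_fls p) n = (if n \<le> 0 then coeff p (nat (- n)) else 0)"
proof (induction p arbitrary: n)
  case (pCons a p)
  have "nat (- n) = Suc (nat (- (n + 1)))" if "n < 0"
    using that by simp
  then show ?case
    using pCons by (auto simp: poly_to_fls_pCons fls_X_inv_times_conv_shift coeff_pCons
        split: nat.split)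
qed simp

lemma poly_to_fls_eq_iff [simp]: "poly_to_fls p = poly_to_fls q \<longleftrightarrow> p = q"
proof
  assume eq: "poly_to_fls p = poly_to_fls q"
  have "coeff p n = coeff q n" for n
    using arg_cong [OF eq, of "\<lambda>f. fls_nth f (- int n)"] by (simp add: poly_to_fls_nth)
  then show "p = q"
    by (simp add: poly_eq_iff)
qed simp

lemma poly_to_fls_eq_0_iff [simp]: "poly_to_fls p = 0 \<longleftrightarrow> p = 0"
  using poly_to_fls_eq_iff [of p 0] by simp

definition ratfun_to_fls :: "'a::field poly fract \<Rightarrow> 'a fls" where
  "ratfun_to_fls r =
    (THE x. \<exists>p q. q \<noteq> 0 \<and> r = Fract p q \<and> x = poly_to_fls p / poly_to_fls q)"

lemma ratfun_to_fls_Fract: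
  assumes "q \<noteq> 0"
  shows "ratfun_to_fls (Fract p q) = poly_to_fls p / poly_to_fls q"
  unfolding ratfun_to_fls_def
proof (rule the_equality)
  fix x assume "\<exists>p' q'. q' \<noteq> 0 \<and> Fract p q = Fract p' q' \<and> x = poly_to_fls p' / poly_to_fls q'"
  then obtain p' q' where *: "q' \<noteq> 0" "p * q' = p' * q" "x = poly_to_fls p' / poly_to_fls q'"
    using assms by (auto simp: eq_fract)
  then show "x = poly_to_fls p / poly_to_fls q"
    using assms by (simp add: frac_eq_eq poly_to_fls_mult [symmetric])
qed (use assms in blast)

lemma range_ratfun_to_fls:
  "range ratfun_to_fls = {poly_to_fls p / poly_to_fls q | p q. q \<noteq> 0}"
proof (intro equalityI subsetI)
  fix x :: "'a fls" assume "x \<in> range ratfun_to_fls"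
  then obtain r where "x = ratfun_to_fls r" by blast
  then show "x \<in> {poly_to_fls p / poly_to_fls q | p q. q \<noteq> 0}"
    by (cases r) (auto simp: ratfun_to_fls_Fract)
next
  fix x :: "'a fls" assume "x \<in> {poly_to_fls p / poly_to_fls q | p q. q \<noteq> 0}"
  then show "x \<in> range ratfun_to_fls"
    by (auto simp: ratfun_to_fls_Fract [symmetric])
qed

definition monic_irreducibles :: "'a::field poly set" where
  "monic_irreducibles = {P. lead_coeff P = 1 \<and> irreducible P}"

end

theory Submission
  imports Defs
begin

text \<open>
  For a finite family \<open>x\<close> in characteristic two, the quotient \<open>e\<^sub>2(x) / p\<^sub>1(x)\<^sup>2\<close> is additive under
  forming all products of two families, and for \<open>1, u, u\<^sup>2, \<dots>\<close> it equals \<open>u / (1 - u)\<close>.  Unique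
  factorisation therefore turns \<open>\<Sum>\<^sub>P 1 / (P\<^sup>k - 1)\<close> into the quotient \<open>e\<^sub>2 / p\<^sub>1\<^sup>2\<close> of the family \<open>a\<^bsup>-k\<^esup>\<close>,
  \<open>a\<close> monic; since \<open>q - 1\<close> divides \<open>k\<close>, letting \<open>a\<close> run over all nonzero polynomials changes it only
  by a constant.  As for Carlitz's zeta values, the coefficients of the lattice function
  \<open>e(z) = z \<Prod>\<^sub>a (1 - z / a)\<close> satisfy \<open>e(T z) = T e(z) + \<beta> e(z)\<^sup>q\<close>, so the coefficient of
  \<open>z\<^bsup>n+1\<^esup>\<close> is \<open>\<beta>\<^bsup>n/(q-1)\<^esup>\<close> times a rational function.  By identities of
  Newton type (using the first and second Hasse derivatives of \<open>e(z) / z\<close>), \<open>p\<^sub>1\<close> and \<open>e\<^sub>2\<close> of the family are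
  rational multiples of \<open>\<beta>\<^bsup>k/(q-1)\<^esup>\<close> and \<open>\<beta>\<^bsup>2k/(q-1)\<^esup>\<close>, and the power of \<open>\<beta>\<close> cancels in the quotient.
\<close>

section \<open>Characteristic two\<close>

lemma char2_add_self:
  fixes x :: "'b::comm_ring_1"
  assumes "(2::'b) = 0"
  shows "x + x = 0"
  using assms by (metis mult_2 mult_zero_left)

lemma char2_uminus:
  fixes x :: "'b::comm_ring_1"
  assumes "(2::'b) = 0"
  shows "- x = x"
  using char2_add_self[OF assms, of x] by (simp add: minus_unique)

lemma char2_add_power:
  fixes x y :: "'b::comm_ring_1"
  assumes "(2::'b) = 0"
  shows "(x + y) ^ (2 ^ n) = x ^ (2 ^ n) + y ^ (2 ^ n)"
proof (induction n)
  case (Suc n)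
  have "(x + y) ^ (2 ^ Suc n) = ((x + y) ^ 2 ^ n)\<^sup>2"
    by (simp add: power_mult [symmetric] mult.commute)
  also have "\<dots> = (x ^ 2 ^ n)\<^sup>2 + (y ^ 2 ^ n)\<^sup>2"
    using assms by (simp add: Suc power2_sum)
  finally show ?case
    by (simp add: power_mult [symmetric] mult.commute)
qed simp

text \<open>Translation by 1 permutes the field, so comparing the sum of all elements with its
  translate shows that the cardinality vanishes in the field. A field has no nilpotents, so this
  power of 2 vanishes only if 2 does.\<close>

lemma two_eq_0_if_card:
  assumes "card (UNIV :: 'a::{field, finite} set) = 2 ^ n"
  shows "(2 :: 'a) = 0"
proof -
  have "(\<Sum>x\<in>UNIV. x) = (\<Sum>x\<in>UNIV. x + (1::'a))"
    by (rule sum.reindex_bij_witness[of _ "\<lambda>x. x + 1" "\<lambda>x. x - 1"]) auto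
  then have "of_nat (card (UNIV :: 'a set)) = (0::'a)"
    by (simp add: sum.distrib)
  then show ?thesis
    using assms by (simp add: of_nat_power)
qed

lemma exponent_pos_if_card:
  assumes "card (UNIV :: 'a::{field, finite} set) = 2 ^ n"
  shows "n > 0"
proof (rule ccontr)
  assume "\<not> n > 0"
  with assms have "card (UNIV :: 'a set) = 1" by simp
  then obtain x :: 'a where "UNIV = {x}" by (rule card_1_singletonE)
  then show False by (metis UNIV_I singletonD zero_neq_one)
qed

lemma fls_two_eq_0: "(2 :: 'a::field) = 0 \<Longrightarrow> (2 :: 'a fls) = 0"
  by (metis fls_const_0 fls_const_numeral)

lemma poly_two_eq_0: "(2 :: 'b::comm_ring_1) = 0 \<Longrightarrow> (2 :: 'b poly) = 0"
  by (metis numeral_poly pCons_0_0)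

section \<open>Frobenius on a finite field\<close>

lemma finite_field_power_card:
  fixes x :: "'a :: {field, finite}"
  shows "x ^ card (UNIV :: 'a set) = x"
proof (cases "x = 0")
  case False
  \<comment> \<open>Multiplication by \<open>x\<close> permutes the nonzero elements.\<close>
  have "(\<Prod>y\<in>UNIV-{0}. y) = (\<Prod>y\<in>UNIV-{0}. x * y)"
    using False by (intro prod.reindex_bij_witness[of _ "\<lambda>y. x * y" "\<lambda>y. y / x"]) auto
  also have "\<dots> = x ^ (card (UNIV :: 'a set) - 1) * (\<Prod>y\<in>UNIV-{0}. y)"
    by (simp add: prod.distrib)
  finally have "x ^ (card (UNIV :: 'a set) - 1) * (\<Prod>y\<in>UNIV-{0::'a}. y) = 1 * (\<Prod>y\<in>UNIV-{0::'a}. y)"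
    by (simp only: mult_1)
  then have "x ^ (card (UNIV :: 'a set) - 1) = 1"
    by (subst (asm) mult_cancel_right) simp
  moreover have "card (UNIV :: 'a set) = Suc (card (UNIV :: 'a set) - 1)"
    using finite_UNIV_card_ge_0[where ?'a = 'a] by simp
  ultimately show ?thesis
    by (metis mult.right_neutral power_Suc)
qed (simp add: finite_UNIV_card_ge_0)

text \<open>As polynomials in \<open>x\<close>, both sides are monic of degree q and vanish at the q
  values of \<open>h\<close>, which are their own negatives; a difference of degree below q with q
  zeros is 0. The target ring is kept general so that \<open>h\<close> can embed the constants into
  polynomials over Laurent series.\<close>

lemma finite_field_prod_add:
  fixes h :: "'a::{field, finite} \<Rightarrow> 'b::idom"
  assumes card: "card (UNIV :: 'a set) = 2 ^ n"
    and inj: "inj h" and pow: "\<And>c. h c ^ 2 ^ n = h c" and two: "(2 :: 'b) = 0"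
  shows "(\<Prod>c\<in>UNIV. x + h c) = x ^ 2 ^ n + x"
proof -
  let ?q = "2 ^ n :: nat"
  have q2: "1 < ?q"
    using exponent_pos_if_card[OF card] by (intro one_less_power) simp_all
  let ?p = "\<Prod>c\<in>UNIV. [:h c, 1:]" and ?r = "monom 1 ?q + [:0, 1 :: 'b:]"
  have dr: "degree ?r = ?q"
    using q2 by (subst degree_add_eq_left) (auto simp: degree_monom_eq)
  have dp: "degree ?p = ?q"
    using card by (subst degree_prod_eq_sum_degree) auto
  have "?p = ?r"
  proof (rule poly_eqI_degree_lead_coeff[of ?p _ ?r "h ` UNIV"])
    show "coeff ?p ?q = coeff ?r ?q"
    proof -
      have "coeff ?p ?q = 1"
        using lead_coeff_prod[of "\<lambda>c. [:h c, 1:]" UNIV] unfolding dp by simp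
      moreover have "coeff [:0, 1 :: 'b:] ?q = 0"
        using q2 by (intro coeff_eq_0) simp
      ultimately show ?thesis by simp
    qed
    show "poly ?p x = poly ?r x" if x: "x \<in> range h" for x
    proof -
      obtain c where c: "x = h c" using x by auto
      have "poly ?p x = 0"
        unfolding poly_prod c using char2_add_self[OF two, of "h c"]
        by (auto intro!: exI[of _ c])
      moreover have "poly ?r x = 0"
        using char2_add_self[OF two, of "h c"] by (simp add: c poly_monom pow)
      ultimately show ?thesis by simp
    qed
  qed (use dr dp card inj in \<open>auto simp: card_image\<close>)
  from arg_cong[OF this, of "\<lambda>p. poly p x"] show ?thesis
    by (simp add: poly_prod poly_monom add_ac)
qed

section \<open>The second elementary symmetric function\<close>

text \<open>Taken as a coefficient of the generating polynomial, whose coefficient of degree 1 is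
  the plain sum: reindexing is inherited from \<open>prod\<close>, and one estimate for coefficients
  covers both.\<close>

definition esym2 :: "('b \<Rightarrow> 'c::comm_ring_1) \<Rightarrow> 'b set \<Rightarrow> 'c" where
  "esym2 f A = coeff (\<Prod>a\<in>A. [:1, f a:]) 2"

lemma coeff_prod_linear:
  assumes "finite A"
  shows "coeff (\<Prod>a\<in>A. [:1, f a:]) 0 = (1 :: 'c::comm_ring_1)"
    and "coeff (\<Prod>a\<in>A. [:1, f a:]) (Suc 0) = (\<Sum>a\<in>A. f a)"
proof -
  show *: "coeff (\<Prod>a\<in>B. [:1, f a:]) 0 = 1" for B :: "'a set"
    by (induction B rule: infinite_finite_induct) (auto simp: coeff_mult)
  show "coeff (\<Prod>a\<in>A. [:1, f a:]) (Suc 0) = (\<Sum>a\<in>A. f a)"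
    using assms by (induction A) (simp_all add: *)
qed

lemma esym2_empty [simp]: "esym2 f {} = 0"
  by (simp add: esym2_def)

lemma esym2_insert:
  "finite A \<Longrightarrow> a \<notin> A \<Longrightarrow> esym2 f (insert a A) = esym2 f A + f a * sum f A"
  by (simp add: esym2_def numeral_2_eq_2 coeff_prod_linear)

lemma esym2_Un_disjoint:
  assumes "finite A" "finite B" "A \<inter> B = {}"
  shows "esym2 f (A \<union> B) = esym2 f A + esym2 f B + sum f A * sum f B"
  using assms(1,3)
proof (induction A)
  case (insert a A)
  then show ?case
    using assms(2) by (simp add: esym2_insert sum.union_disjoint algebra_simps)
qed simp

lemma esym2_reindex: "inj_on h A \<Longrightarrow> esym2 f (h ` A) = esym2 (f \<circ> h) A"
  by (simp add: esym2_def prod.reindex)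

lemma esym2_cong: "(\<And>a. a \<in> A \<Longrightarrow> f a = g a) \<Longrightarrow> esym2 f A = esym2 g A"
  by (simp add: esym2_def)

lemma esym2_mult_left: "finite A \<Longrightarrow> esym2 (\<lambda>a. c * f a) A = c\<^sup>2 * esym2 f A"
  by (induction A rule: finite_induct)
     (simp_all add: esym2_insert sum_distrib_left [symmetric] algebra_simps power2_eq_square)

text \<open>Over a general commutative ring there is a further term
  \<open>- 2 * esym2 f A * esym2 g B\<close>, which characteristic two removes. Hence
  \<open>esym2\<close> divided by the squared sum is additive under forming product
  families.\<close>

lemma esym2_Times:
  fixes f :: "'a \<Rightarrow> 'c::comm_ring_1" and g :: "'b \<Rightarrow> 'c"
  assumes "finite A" "finite B" "(2 :: 'c) = 0"
  shows "esym2 (\<lambda>(a, b). f a * g b) (A \<times> B) = esym2 f A * (sum g B)\<^sup>2 + (sum f A)\<^sup>2 * esym2 g B"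
  using assms(1)
proof (induction A)
  case (insert a A)
  let ?h = "\<lambda>(a, b). f a * g b"
  have a: "{a} \<times> B = Pair a ` B" and inj: "inj_on (Pair a) B"
    by (auto simp: inj_on_def)
  have "esym2 ?h ({a} \<times> B) = (f a)\<^sup>2 * esym2 g B"
    unfolding a esym2_reindex[OF inj] using assms(2) by (simp add: comp_def esym2_mult_left)
  moreover have "sum ?h ({a} \<times> B) = f a * sum g B"
    unfolding a sum.reindex[OF inj] by (simp add: comp_def sum_distrib_left)
  moreover have "sum ?h (A \<times> B) = sum f A * sum g B"
    by (simp add: sum_product sum.cartesian_product)
  moreover have "insert a A \<times> B = {a} \<times> B \<union> A \<times> B" "({a} \<times> B) \<inter> (A \<times> B) = {}"
    using insert by auto
  ultimately have "esym2 ?h (insert a A \<times> B) =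
      (f a)\<^sup>2 * esym2 g B + esym2 ?h (A \<times> B) + f a * sum g B * (sum f A * sum g B)"
    using insert assms(2) by (simp only: esym2_Un_disjoint finite_cartesian_product finite.intros)
  then show ?case
    using insert assms(3) by (simp add: esym2_insert power2_sum power2_eq_square algebra_simps)
qed (simp_all)

lemma esym2_image_Times:
  fixes f :: "'a \<Rightarrow> 'c::comm_ring_1" and g :: "'b \<Rightarrow> 'c"
  assumes "finite A" "finite B" "(2 :: 'c) = 0"
    and inj: "inj_on (\<lambda>(a, b). m a b) (A \<times> B)"
    and h: "\<And>a b. a \<in> A \<Longrightarrow> b \<in> B \<Longrightarrow> h (m a b) = f a * g b"
  shows "esym2 h ((\<lambda>(a, b). m a b) ` (A \<times> B))
        = esym2 f A * (sum g B)\<^sup>2 + (sum f A)\<^sup>2 * esym2 g B"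
    and "sum h ((\<lambda>(a, b). m a b) ` (A \<times> B)) = sum f A * sum g B"
proof -
  have "esym2 h ((\<lambda>(a, b). m a b) ` (A \<times> B)) = esym2 (\<lambda>(a, b). f a * g b) (A \<times> B)"
    unfolding esym2_reindex[OF inj] by (rule esym2_cong) (auto simp: h)
  then show "esym2 h ((\<lambda>(a, b). m a b) ` (A \<times> B))
        = esym2 f A * (sum g B)\<^sup>2 + (sum f A)\<^sup>2 * esym2 g B"
    using assms by (simp add: esym2_Times)
  have "sum h ((\<lambda>(a, b). m a b) ` (A \<times> B)) = sum (\<lambda>(a, b). f a * g b) (A \<times> B)"
    unfolding sum.reindex[OF inj] by (rule sum.cong) (auto simp: h)
  then show "sum h ((\<lambda>(a, b). m a b) ` (A \<times> B)) = sum f A * sum g B"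
    by (simp add: sum_product sum.cartesian_product)
qed

text \<open>The full geometric sequence has quotient \<open>u / (1 + u)\<close>, which is
  \<open>u / (1 - u)\<close> in characteristic two. This is the truncated form, with an error
  carrying the factor \<open>u ^ Suc n\<close>.\<close>

lemma esym2_geometric:
  fixes u :: "'c::field"
  assumes "(2 :: 'c) = 0" "u \<noteq> 1"
  shows "esym2 (\<lambda>j. u ^ j) {..n} + u / (1 + u) * (\<Sum>j\<le>n. u ^ j)\<^sup>2
        = u ^ Suc n / (1 + u) * (\<Sum>j\<le>n. u ^ j)"
proof (induction n)
  case 0
  have "esym2 ((^) u) (insert (0::nat) {}) = 0"
    by (subst esym2_insert) simp_all
  then show ?case by simp
next
  case (Suc n)
  define s where "s = (\<Sum>j\<le>n. u ^ j)"
  define v where "v = u ^ Suc n"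
  have nz: "1 + u \<noteq> 0"
  proof
    assume "1 + u = 0"
    then have "u = - 1" by (simp add: eq_neg_iff_add_eq_0 add.commute)
    then show False using assms(2) char2_uminus[OF assms(1), of 1] by simp
  qed
  have s: "s * (1 + u) = 1 + v"
  proof -
    have "s * (1 - u) = 1 - v"
      using sum_gp0[of u n] assms by (simp add: s_def v_def)
    then show ?thesis
      using char2_uminus[OF assms(1), of u] char2_uminus[OF assms(1), of v]
      by (simp only: diff_conv_add_uminus)
  qed
  have e: "esym2 (\<lambda>j. u ^ j) {..Suc n} = esym2 (\<lambda>j. u ^ j) {..n} + v * s"
    by (simp add: atMost_Suc esym2_insert s_def v_def)
  let ?e = "esym2 (\<lambda>j. u ^ j) {..n}"
  have "(1 + u) * (?e + u / (1 + u) * s\<^sup>2) = (1 + u) * (v / (1 + u) * s)"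
    using Suc by (simp only: s_def v_def)
  then have "(1 + u) * ?e + u * s\<^sup>2 = v * s"
    using nz by (simp add: distrib_left)
  then have e0: "(1 + u) * ?e = v * s + u * s\<^sup>2"
    using char2_add_self[OF assms(1), of "u * s\<^sup>2"]
    by (metis add.assoc add.right_neutral)
  have "(1 + u) * (esym2 (\<lambda>j. u ^ j) {..Suc n} + u / (1 + u) * (s + v)\<^sup>2)
      = (1 + u) * ?e + (1 + u) * (v * s) + u * (s + v)\<^sup>2"
    using nz by (simp add: e distrib_left)
  also have "\<dots> = (1 + u) * ?e + (1 + u) * (v * s) + u * (s\<^sup>2 + v\<^sup>2)"
    using assms(1) by (simp add: power2_sum)
  \<comment> \<open>Grouped so that the first two brackets are doubles and vanish.\<close>
  also have "\<dots>
      = (v * s + v * s) + (u * s\<^sup>2 + u * s\<^sup>2) + (u * v * s + u * v\<^sup>2)"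
    unfolding e0 by (simp add: algebra_simps)
  also have "\<dots> = (1 + u) * (u * v / (1 + u) * (s + v))"
    using nz assms(1) by (simp add: distrib_left power2_eq_square)
  finally have "esym2 (\<lambda>j. u ^ j) {..Suc n} + u / (1 + u) * (s + v)\<^sup>2 = u * v / (1 + u) * (s + v)"
    using nz by (simp only: mult_cancel_left) simp
  then show ?case
    by (simp add: s_def v_def)
qed

section \<open>Congruences between Laurent series\<close>

text \<open>Says that \<open>x\<close> is O(T^(-N)), that is, of valuation at least
  \<open>N\<close>. It is written by coefficients because \<open>fls_subdegree 0 = 0\<close>,
  whereas 0 must be small of every order.\<close>

definition small :: "int \<Rightarrow> 'a::zero fls \<Rightarrow> bool" where
  "small N x \<longleftrightarrow> (\<forall>n<N. fls_nth x n = 0)"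

lemma small_0 [simp]: "small N 0"
  by (simp add: small_def)

lemma small_mono: "small N x \<Longrightarrow> M \<le> N \<Longrightarrow> small M x"
  by (auto simp: small_def)

lemma small_iff_subdegree: "x \<noteq> 0 \<Longrightarrow> small N x \<longleftrightarrow> N \<le> fls_subdegree x"
  by (auto simp: small_def intro: fls_subdegree_geI)

lemma small_subdegree: "small (fls_subdegree x) x"
  by (simp add: small_def)

lemma small_add: "small N x \<Longrightarrow> small N y \<Longrightarrow> small N (x + y)"
  for x y :: "'a::comm_ring_1 fls"
  by (simp add: small_def)

lemma small_diff: "small N x \<Longrightarrow> small N y \<Longrightarrow> small N (x - y)"
  for x y :: "'a::comm_ring_1 fls"
  by (simp add: small_def)

lemma small_sum: "(\<And>a. a \<in> A \<Longrightarrow> small N (f a)) \<Longrightarrow> small N (sum f A)"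
  for f :: "'b \<Rightarrow> 'a::comm_ring_1 fls"
  by (induction A rule: infinite_finite_induct) (auto intro: small_add)

lemma small_mult: "small M x \<Longrightarrow> small N y \<Longrightarrow> small (M + N) (x * y)"
  for x y :: "'a::idom fls"
  by (cases "x = 0 \<or> y = 0") (auto simp: small_iff_subdegree)

lemma small_mult_left: "small 0 x \<Longrightarrow> small N y \<Longrightarrow> small N (x * y)"
  for x y :: "'a::idom fls"
  using small_mult[of 0 x N y] by simp

lemma small_mult_right: "small N x \<Longrightarrow> small 0 y \<Longrightarrow> small N (x * y)"
  for x y :: "'a::idom fls"
  using small_mult[of N x 0 y] by simp

lemma small_1 [simp]: "small 0 (1 :: 'a::comm_ring_1 fls)"
  by (simp add: small_def)

lemma small_power: "small N x \<Longrightarrow> small (int k * N) (x ^ k)"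
  for x :: "'a::idom fls"
proof (induction k)
  case (Suc k)
  then show ?case
    using small_mult[of N x "int k * N" "x ^ k"] by (simp add: algebra_simps)
qed simp

lemma small_power0: "small 0 x \<Longrightarrow> small 0 (x ^ k)"
  for x :: "'a::idom fls"
  using small_power[of 0 x k] by simp

lemma small_inverse_unit:
  fixes x :: "'a::field fls"
  assumes "small 1 (x - 1)"
  shows "x \<noteq> 0" "small 0 (inverse x)"
proof -
  have x: "fls_nth x n = fls_nth 1 n" if "n < 1" for n
    using assms that by (simp add: small_def)
  from x[of 0] show "x \<noteq> 0"
    by auto
  have "fls_subdegree x = 0"
    by (rule fls_subdegree_eqI) (simp_all add: x)
  then show "small 0 (inverse x)"
    using small_subdegree[of "inverse x"] by simp
qed

text \<open>Adjoining a factor \<open>[:1, f c:]\<close> changes each coefficient by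
  \<open>f c\<close> times a coefficient of the previous product. Those coefficients are integral,
  so a factor with \<open>f c\<close> of order \<open>N\<close> changes nothing modulo
  T^(-N).\<close>

lemma small_coeff_prod_diff:
  fixes f :: "'b \<Rightarrow> 'a::idom fls"
  assumes "finite B" "A \<subseteq> B"
    and "\<And>b. b \<in> B \<Longrightarrow> small 0 (f b)" "\<And>b. b \<in> B - A \<Longrightarrow> small N (f b)"
  shows "small N (coeff (\<Prod>b\<in>B. [:1, f b:]) i - coeff (\<Prod>b\<in>A. [:1, f b:]) i)"
proof -
  let ?c = "\<lambda>A. coeff (\<Prod>b\<in>A. [:1, f b:])"
  have c_insert: "?c (insert c C) i = ?c C i + (case i of 0 \<Rightarrow> 0 | Suc j \<Rightarrow> f c * ?c C j)"
    if "finite C" "c \<notin> C" for c C i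
    using that by (simp add: coeff_pCons split: nat.split)
  have c0: "small 0 (?c C i)" if "finite C" "C \<subseteq> B" for C i
    using that
  proof (induction C arbitrary: i)
    case empty
    then show ?case by (cases i) simp_all
  next
    case (insert c C)
    then have "small 0 (f c * ?c C j)" for j
      using assms(3) by (intro small_mult_left) auto
    then show ?case
      unfolding c_insert[OF insert(1,2)] using insert
      by (intro small_add) (auto split: nat.split)
  qed
  have "small N (?c (A \<union> C) i - ?c A i)" if "finite C" "C \<subseteq> B - A" for C
    using that
  proof (induction C)
    case (insert c C)
    have fin: "finite (A \<union> C)"
      using insert assms by (auto intro: finite_subset)
    have "small N (f c * ?c (A \<union> C) j)" for j
      using insert assms fin by (intro small_mult_right c0) auto
    then have "small N (case i of 0 \<Rightarrow> 0 | Suc j \<Rightarrow> f c * ?c (A \<union> C) j)"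
      by (auto split: nat.split)
    with insert have "small N ((?c (A \<union> C) i - ?c A i) + (case i of 0 \<Rightarrow> 0 | Suc j \<Rightarrow> f c * ?c (A \<union> C) j))"
      by (intro small_add) auto
    moreover have "c \<notin> A \<union> C" "A \<union> insert c C = insert c (A \<union> C)"
      using insert by auto
    ultimately show ?case
      using c_insert[OF fin] by (simp add: algebra_simps)
  qed simp
  from this[of "B - A"] assms show ?thesis
    by (simp add: Un_absorb1)
qed

lemma small_esym2_diff:
  fixes f :: "'b \<Rightarrow> 'a::idom fls"
  assumes "finite B" "A \<subseteq> B"
    and "\<And>b. b \<in> B \<Longrightarrow> small 0 (f b)" "\<And>b. b \<in> B - A \<Longrightarrow> small N (f b)"
  shows "small N (esym2 f B - esym2 f A)" "small N (sum f B - sum f A)"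
  using small_coeff_prod_diff[where i = 2, OF assms] small_coeff_prod_diff[where i = "Suc 0", OF assms]
    assms(1) finite_subset[OF assms(2,1)]
  by (simp_all add: esym2_def coeff_prod_linear)

section \<open>Negative powers of polynomials\<close>

lemma fls_subdegree_poly_to_fls: "fls_subdegree (poly_to_fls p) = - int (degree p)"
proof (cases "p = 0")
  case False
  show ?thesis
    by (rule fls_subdegree_eqI) (use False in \<open>auto simp: poly_to_fls_nth coeff_eq_0\<close>)
qed simp

definition zterm :: "nat \<Rightarrow> 'a::field poly \<Rightarrow> 'a fls" where
  "zterm k a = inverse (poly_to_fls a ^ k)"

lemma zterm_1 [simp]: "zterm k 1 = 1"
  by (simp add: zterm_def)

lemma zterm_mult: "zterm k (a * b) = zterm k a * zterm k b"
  by (simp add: zterm_def poly_to_fls_mult power_mult_distrib)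

lemma zterm_power: "zterm k (a ^ j) = zterm k a ^ j"
  by (induction j) (simp_all add: zterm_mult)

lemma small_zterm: "small (int k * int (degree a)) (zterm k a)"
  using small_power[OF small_subdegree[of "inverse (poly_to_fls a)"], of k]
  by (simp add: zterm_def power_inverse fls_subdegree_poly_to_fls)

lemma small_zterm_0: "small 0 (zterm k a)"
  using small_zterm by (rule small_mono) simp

section \<open>The Euler product\<close>

lemma monic_irreducible_divisor:
  fixes a :: "'a::field poly"
  assumes "degree a > 0"
  shows "\<exists>P\<in>monic_irreducibles. P dvd a"
  using assms
proof (induction "degree a" arbitrary: a rule: less_induct)
  case less
  then have nz: "a \<noteq> 0" by auto
  show ?case
  proof (cases "irreducible a")
    case True
    let ?P = "smult (inverse (lead_coeff a)) a"
    have "?P dvd a" "a dvd ?P"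
      using nz by (auto simp: smult_dvd_iff dvd_smult)
    moreover have "irreducible ?P"
      using True nz irreducible_mult_unit_left[of "[:inverse (lead_coeff a):]" a]
      by (simp add: is_unit_pCons_iff)
    ultimately show ?thesis
      using nz by (intro bexI[of _ ?P]) (auto simp: monic_irreducibles_def)
  next
    case False
    then obtain b c where bc: "a = b * c" "\<not> is_unit b" "\<not> is_unit c"
      using nz less(2) by (auto simp: irreducible_def is_unit_iff_degree)
    then have "degree b > 0" "degree c > 0" "degree a = degree b + degree c"
      using nz by (auto simp: is_unit_iff_degree degree_mult_eq)
    then obtain P where "P \<in> monic_irreducibles" "P dvd b"
      using less(1)[of b] by auto
    then show ?thesis
      using bc by (metis dvd_mult2)
  qed
qed

lemma poly_power_decomposition:
  fixes P a :: "'a::field poly"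
  assumes "degree P > 0" "a \<noteq> 0"
  shows "\<exists>j b. a = b * P ^ j \<and> \<not> P dvd b"
  using assms(2)
proof (induction "degree a" arbitrary: a rule: less_induct)
  case less
  show ?case
  proof (cases "P dvd a")
    case True
    then obtain c where c: "a = P * c" by auto
    then have "degree c < degree a" "c \<noteq> 0"
      using less(2) assms(1) by (auto simp: degree_mult_eq)
    then obtain j b where "c = b * P ^ j" "\<not> P dvd b"
      using less(1) by blast
    then show ?thesis
      using c by (intro exI[of _ "Suc j"] exI[of _ b]) (auto simp: mult_ac)
  next
    case False
    then show ?thesis
      by (intro exI[of _ 0] exI[of _ a]) simp
  qed
qed

lemma monic_irreduciblesD:
  assumes "(P :: 'a::field poly) \<in> monic_irreducibles"
  shows "lead_coeff P = 1" "irreducible P" "prime_elem P" "degree P > 0" "P \<noteq> 0"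
proof -
  show 1: "lead_coeff P = 1" "irreducible P"
    using assms by (auto simp: monic_irreducibles_def)
  then show "prime_elem P"
    by (intro field_poly_irreducible_imp_prime)
  show "degree P > 0" "P \<noteq> 0"
    using 1 by (auto simp: irreducible_def is_unit_iff_degree)
qed

lemma monic_dvd_irreducible_eq:
  fixes P Q :: "'a::field poly"
  assumes "P \<in> monic_irreducibles" "Q \<in> monic_irreducibles" "P dvd Q"
  shows "P = Q"
proof -
  obtain c where c: "Q = P * c" using assms by auto
  then have "is_unit c"
    using monic_irreduciblesD(2,4)[OF assms(1)] monic_irreduciblesD(2)[OF assms(2)]
    by (auto simp: irreducible_def)
  then obtain u where u: "c = [:u:]" "u \<noteq> 0"
    by (fastforce simp: is_unit_poly_iff)
  with c assms have "u = 1"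
    by (auto simp: monic_irreducibles_def)
  with u c show ?thesis by simp
qed

text \<open>If the exponents differed, cancelling the smaller power would leave \<open>P\<close>
  dividing \<open>a\<close> or \<open>b\<close>. This makes the map from \<open>(a, j)\<close> to
  \<open>a * P ^ j\<close> injective on polynomials \<open>a\<close> not divisible by
  \<open>P\<close>.\<close>

lemma mult_prime_power_cancel:
  fixes P a b :: "'a::field poly"
  assumes "P \<noteq> 0" "a * P ^ i = b * P ^ j" "\<not> P dvd a" "\<not> P dvd b"
  shows "i = j \<and> a = b"
proof -
  have *: "i \<le> j" if "a * P ^ i = b * P ^ j" "\<not> P dvd b" for a b i j
  proof (rule ccontr)
    assume "\<not> i \<le> j"
    then have "P ^ i = P * P ^ (i - j - 1) * P ^ j"
      by (simp flip: power_Suc power_add)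
    then have "(a * (P * P ^ (i - j - 1))) * P ^ j = b * P ^ j"
      using that(1) by (simp add: mult.assoc)
    then have "a * (P * P ^ (i - j - 1)) = b"
      using assms(1) by simp
    with that(2) show False by (metis dvd_mult dvd_triv_left)
  qed
  have "i = j"
    using *[of a i b j] *[of b j a i] assms by auto
  with assms show ?thesis by simp
qed

text \<open>For \<open>S\<close> a set of monic irreducibles this is the monoid they generate, over
  which the Euler product of \<open>S\<close> expands.\<close>

definition supported :: "'a::field poly set \<Rightarrow> 'a poly \<Rightarrow> bool" where
  "supported S a \<longleftrightarrow> lead_coeff a = 1 \<and> (\<forall>P\<in>monic_irreducibles. P dvd a \<longrightarrow> P \<in> S)"

text \<open>With \<open>u = zterm k P\<close> the summand is \<open>u / (1 + u)\<close>, so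
  \<open>esym2_geometric\<close> leaves an error with the factor \<open>u ^ Suc R\<close>. As
  \<open>P\<close> is not constant, \<open>u\<close> has order at least 1. The plus sign stands for
  a minus sign.\<close>

lemma small_single_prime:
  fixes P :: "'a::field poly"
  assumes "P \<in> monic_irreducibles" "k > 0" "(2::'a) = 0"
  defines "g \<equiv> \<lambda>j. zterm k P ^ j"
  shows "small (int R + 1) (esym2 g {..R} + (sum g {..R})\<^sup>2 * (1 / (poly_to_fls P ^ k - 1)))"
proof -
  define u where "u = zterm k P"
  have two: "(2 :: 'a fls) = 0"
    using assms(3) by (rule fls_two_eq_0)
  have su: "small 1 u"
    using small_zterm[of k P] monic_irreduciblesD(4)[OF assms(1)] assms(2)
    unfolding u_def by (rule_tac small_mono) (auto simp flip: of_nat_mult)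
  have "small 1 ((1 + u) - 1)" using su by simp
  note v = small_inverse_unit[OF this]
  have "u \<noteq> 0"
    using monic_irreduciblesD(5)[OF assms(1)] by (simp add: u_def zterm_def)
  have "u \<noteq> 1"
    using v(1) two by auto
  have "1 / (poly_to_fls P ^ k - 1) = 1 / (1 / u - 1)"
    by (simp add: u_def zterm_def inverse_eq_divide)
  also have "1 / u - 1 = (1 + u) / u"
    using \<open>u \<noteq> 0\<close> char2_uminus[OF two, of u] by (simp add: divide_simps) 
  finally have h: "1 / (poly_to_fls P ^ k - 1) = u / (1 + u)"
    by simp
  have "small (int R + 1) (u ^ Suc R)"
    using small_power[OF su, of "Suc R"] by (simp add: add.commute)
  then have "small (int R + 1) (u ^ Suc R * inverse (1 + u) * (\<Sum>j\<le>R. u ^ j))"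
    using v(2) by (intro small_mult_right small_sum small_power0 small_mono[OF su]) auto
  moreover have "esym2 g {..R} + (sum g {..R})\<^sup>2 * (u / (1 + u))
      = u ^ Suc R * inverse (1 + u) * (\<Sum>j\<le>R. u ^ j)"
    using esym2_geometric[OF two \<open>u \<noteq> 1\<close>, of R]
    by (simp add: g_def u_def [symmetric] divide_inverse mult_ac)
  ultimately show ?thesis
    unfolding h by simp
qed

text \<open>The Euler product, by induction on \<open>S\<close>: adjoining \<open>P\<close>
  multiplies the family on \<open>M\<close> by the powers of P^(-k), so the quotient of
  \<open>esym2\<close> by the squared sum grows by the summand of \<open>P\<close>. The set
  \<open>M\<close> is a finite piece of the monoid of \<open>S\<close> that contains everything of
  degree at most \<open>R\<close> and possibly more.\<close>

lemma supported_esym2: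
  fixes S :: "'a::field poly set"
  assumes "finite S" "S \<subseteq> monic_irreducibles" "k > 0" "(2::'a) = 0"
  shows "\<exists>M. finite M \<and> (\<forall>m\<in>M. supported S m) \<and> (\<forall>a. supported S a \<and> degree a \<le> R \<longrightarrow> a \<in> M) \<and>
    small (int R + 1) (esym2 (zterm k) M
      + (sum (zterm k) M)\<^sup>2 * (\<Sum>P\<in>S. 1 / (poly_to_fls P ^ k - 1)))"
  using assms(1,2)
proof (induction S)
  case empty
  have "a = 1" if "supported {} a" for a :: "'a poly"
  proof -
    have "degree a = 0"
      using that monic_irreducible_divisor[of a] by (auto simp: supported_def)
    with that show ?thesis
      by (auto simp: supported_def elim!: degree_eq_zeroE)
  qed
  moreover have "\<not> P dvd 1" if "P \<in> monic_irreducibles" for P :: "'a poly"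
    using monic_irreduciblesD(2)[OF that] by (auto simp: irreducible_def)
  then have "supported {} (1 :: 'a poly)"
    by (auto simp: supported_def)
  moreover have "esym2 (zterm k) (insert 1 {}) = (0 :: 'a fls)"
    by (subst esym2_insert) simp_all
  ultimately show ?case
    by (intro exI[of _ "{1}"]) auto
next
  case (insert P S)
  then obtain M where M: "finite M" "\<And>m. m \<in> M \<Longrightarrow> supported S m"
    "\<And>a. supported S a \<Longrightarrow> degree a \<le> R \<Longrightarrow> a \<in> M"
    "small (int R + 1) (esym2 (zterm k) M
      + (sum (zterm k) M)\<^sup>2 * (\<Sum>P\<in>S. 1 / (poly_to_fls P ^ k - 1)))"
    by auto
  have P: "P \<in> monic_irreducibles" using insert by simp
  note PD = monic_irreduciblesD[OF P]
  define g where "g = (\<lambda>j. zterm k P ^ j)"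
  define m where "m = (\<lambda>(a, j). a * P ^ j)"
  let ?N = "m ` (M \<times> {..R})"
  let ?h = "\<lambda>P. 1 / (poly_to_fls P ^ k - 1)"
  have ndvd: "\<not> P dvd a" if "a \<in> M" for a
    using M(2)[OF that] P insert(2) by (auto simp: supported_def)
  have inj: "inj_on m (M \<times> {..R})"
  proof (rule inj_onI)
    fix x y assume xy: "x \<in> M \<times> {..R}" "y \<in> M \<times> {..R}" "m x = m y"
    then obtain a i b j where ab: "x = (a, i)" "y = (b, j)" "a \<in> M" "b \<in> M"
      by auto
    then show "x = y"
      using mult_prime_power_cancel[OF PD(5) _ ndvd ndvd, of a i b j] xy(3) by (simp add: m_def)
  qed
  have two: "(2 :: 'a fls) = 0"
    using assms(4) by (rule fls_two_eq_0)
  have sums: "esym2 (zterm k) ?N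
        = esym2 (zterm k) M * (sum g {..R})\<^sup>2 + (sum (zterm k) M)\<^sup>2 * esym2 g {..R}"
      "sum (zterm k) ?N = sum (zterm k) M * sum g {..R}"
    using esym2_image_Times[where m = "\<lambda>a j. a * P ^ j" and f = "zterm k" and g = g
        and h = "zterm k", OF M(1) finite_atMost two inj[unfolded m_def]]
    by (simp_all add: g_def m_def zterm_mult zterm_power)
  have "supported (insert P S) (m x)" if xM: "x \<in> M \<times> {..R}" for x
  proof -
    obtain a j where x: "x = (a, j)" "a \<in> M" using xM by (cases x) auto
    have "Q \<in> insert P S" if Q: "Q \<in> monic_irreducibles" "Q dvd a * P ^ j" for Q
    proof -
      note pr = monic_irreduciblesD(3)[OF Q(1)]
      from Q(2) pr have "Q dvd a \<or> Q dvd P"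
        using prime_elem_dvd_mult_iff prime_elem_dvd_power by blast
      then show ?thesis
        using M(2)[OF x(2)] Q(1) monic_dvd_irreducible_eq[OF Q(1) P] by (auto simp: supported_def)
    qed
    then show ?thesis
      using M(2)[OF x(2)] PD(1) by (auto simp: x m_def supported_def lead_coeff_mult lead_coeff_power)
  qed
  moreover have "a \<in> ?N" if a: "supported (insert P S) a" "degree a \<le> R" for a
  proof -
    have "a \<noteq> 0" using a by (auto simp: supported_def)
    then obtain j b where jb: "a = b * P ^ j" "\<not> P dvd b"
      using poly_power_decomposition[OF PD(4)] by blast
    have "b \<noteq> 0" using jb \<open>a \<noteq> 0\<close> by auto
    then have deg: "degree a = degree b + j * degree P"
      using jb PD(5) by (simp add: degree_mult_eq degree_power_eq)
    have "supported S b"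
      using a(1) jb PD(1) by (auto simp: supported_def lead_coeff_mult lead_coeff_power)
    then have "b \<in> M"
      using M(3) deg a(2) by auto
    \<comment> \<open>This is why exponents up to \<open>R\<close> suffice: each factor
      \<open>P\<close> costs at least one degree.\<close>
    moreover have "j \<le> j * degree P"
      using PD(4) by simp
    then have "j \<le> R"
      using deg a(2) by linarith
    ultimately show ?thesis
      using jb by (auto simp: m_def)
  qed
  moreover have "small (int R + 1) (esym2 (zterm k) ?N + (sum (zterm k) ?N)\<^sup>2 * sum ?h (insert P S))"
  proof -
    \<comment> \<open>The claim is the sum of the induction hypothesis times
      \<open>(sum g {..R})\<^sup>2\<close> and the congruence for \<open>P\<close> times
      \<open>(sum (zterm k) M)\<^sup>2\<close>.\<close>
    have "small (int R + 1) ((esym2 (zterm k) M + (sum (zterm k) M)\<^sup>2 * sum ?h S) * (sum g {..R})\<^sup>2)"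
      by (intro small_mult_right M(4) small_power0 small_sum) (auto simp: g_def intro!: small_power0 small_zterm_0)
    moreover have "small (int R + 1) ((sum (zterm k) M)\<^sup>2 * (esym2 g {..R} + (sum g {..R})\<^sup>2 * ?h P))"
      unfolding g_def using small_single_prime[OF P assms(3,4)]
      by (intro small_mult_left small_power0 small_sum) (auto intro!: small_zterm_0)
    ultimately have "small (int R + 1)
        ((esym2 (zterm k) M + (sum (zterm k) M)\<^sup>2 * sum ?h S) * (sum g {..R})\<^sup>2
        + (sum (zterm k) M)\<^sup>2 * (esym2 g {..R} + (sum g {..R})\<^sup>2 * ?h P))"
      by (rule small_add)
    moreover have "sum ?h (insert P S) = ?h P + sum ?h S"
      using insert(1,2) by simp
    ultimately show ?thesis
      unfolding sums by (simp only: ring_distribs power_mult_distrib add_ac mult_ac)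
  qed
  ultimately show ?case
    using M(1) by (intro exI[of _ ?N]) auto
qed

section \<open>Limits of Laurent series\<close>

text \<open>T^(-1)-adic convergence in terms of valuations; the library metric enters only at the
  end, through \<open>dist_le_if_small\<close>.\<close>

definition converges :: "(nat \<Rightarrow> 'a::field fls) \<Rightarrow> 'a fls \<Rightarrow> bool" where
  "converges x L \<longleftrightarrow> (\<forall>N. \<exists>D. \<forall>d\<ge>D. small N (x d - L))"

lemma converges_const [simp]: "converges (\<lambda>d. c) c"
  by (simp add: converges_def)

lemma converges_Suc: "converges x L \<Longrightarrow> converges (\<lambda>d. x (Suc d)) L"
  unfolding converges_def by (meson le_SucI)

lemma converges_add: "converges x L \<Longrightarrow> converges y M \<Longrightarrow> converges (\<lambda>d. x d + y d) (L + M)"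
  unfolding converges_def
proof
  fix N assume *: "\<forall>N. \<exists>D. \<forall>d\<ge>D. small N (x d - L)" "\<forall>N. \<exists>D. \<forall>d\<ge>D. small N (y d - M)"
  obtain D E where "\<And>d. d \<ge> D \<Longrightarrow> small N (x d - L)" "\<And>d. d \<ge> E \<Longrightarrow> small N (y d - M)"
    using * by meson
  then have "small N ((x d - L) + (y d - M))" if "d \<ge> max D E" for d
    using that by (intro small_add) auto
  then have "small N (x d + y d - (L + M))" if "d \<ge> max D E" for d
    using that by (simp add: add_diff_add)
  then show "\<exists>D. \<forall>d\<ge>D. small N (x d + y d - (L + M))"
    by blast
qed

lemma converges_mult:
  assumes "converges x L" "converges y M"
  shows "converges (\<lambda>d. x d * y d) (L * M)"
  unfolding converges_def
proof
  fix N
  let ?a = "fls_subdegree L" and ?b = "fls_subdegree M"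
  obtain D where D: "\<And>d. d \<ge> D \<Longrightarrow> small (max 0 (N - ?b)) (x d - L)"
    using assms(1) unfolding converges_def by meson
  obtain E where E: "\<And>d. d \<ge> E \<Longrightarrow> small (max N (N - ?a)) (y d - M)"
    using assms(2) unfolding converges_def by meson
  have "small N (x d * y d - L * M)" if "d \<ge> max D E" for d
  proof -
    have x: "small 0 (x d - L)" "small (N - ?b) (x d - L)"
      using D[of d] that by (auto intro: small_mono)
    have y: "small N (y d - M)" "small (N - ?a) (y d - M)"
      using E[of d] that by (auto intro: small_mono)
    have "small N ((x d - L) * (y d - M))" "small N ((x d - L) * M)" "small N (L * (y d - M))"
      using small_mult_left[OF x(1) y(1)] small_mult[OF x(2) small_subdegree[of M]]
        small_mult[OF small_subdegree[of L] y(2)] by simp_all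
    then have "small N ((x d - L) * (y d - M) + (x d - L) * M + L * (y d - M))"
      by (intro small_add)
    then show ?thesis
      by (simp add: algebra_simps)
  qed
  then show "\<exists>D. \<forall>d\<ge>D. small N (x d * y d - L * M)"
    by blast
qed

lemma converges_diff:
  assumes "converges x L" "converges y M"
  shows "converges (\<lambda>d. x d - y d) (L - M)"
  using converges_add[OF assms(1) converges_mult[OF converges_const[of "-1"] assms(2)]] by simp

lemma converges_power: "converges x L \<Longrightarrow> converges (\<lambda>d. x d ^ n) (L ^ n)"
  by (induction n) (auto intro: converges_mult)

lemma converges_unique:
  assumes "converges x L" "converges x M"
  shows "L = M"
proof -
  have "small N (L - M)" for N
  proof -
    obtain D E where "\<And>d. d \<ge> D \<Longrightarrow> small N (x d - L)" "\<And>d. d \<ge> E \<Longrightarrow> small N (x d - M)"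
      using assms unfolding converges_def by meson
    then have "small N ((x (max D E) - M) - (x (max D E) - L))"
      by (rule_tac small_diff) auto
    then show ?thesis by simp
  qed
  then have "fls_nth (L - M) n = 0" for n
    by (metis small_def zless_add1_eq)
  then show ?thesis
    by (metis eq_iff_diff_eq_0 fls_eqI fls_zero_nth)
qed

lemma converges_small:
  assumes "converges x L" "\<And>d. d \<ge> D \<Longrightarrow> small N (x d)"
  shows "small N L"
proof -
  obtain E where "\<And>d. d \<ge> E \<Longrightarrow> small N (x d - L)"
    using assms(1) unfolding converges_def by meson
  then have "small N (x (max D E) - (x (max D E) - L))"
    using assms(2) by (rule_tac small_diff) auto
  then show ?thesis by simp
qed

text \<open>Completeness: the steps from index \<open>d\<close> on leave all coefficients below
  \<open>d\<close> fixed, and integrality makes the limit a power series.\<close>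

lemma converges_if_small_steps:
  assumes "\<And>d. small 0 (x d)" "\<And>d. small (int d) (x (Suc d) - x d)"
  shows "\<exists>L. converges x L"
proof -
  have step: "small (int d) (x (d + e) - x d)" for d e
  proof (induction e)
    case (Suc e)
    have "small (int d) ((x (Suc (d + e)) - x (d + e)) + (x (d + e) - x d))"
      using assms(2)[of "d + e"] Suc by (intro small_add) (auto intro: small_mono)
    then show ?case by simp
  qed simp
  \<comment> \<open>Coefficient \<open>n\<close> is frozen from index \<open>Suc n\<close> on, hence
    is read off there.\<close>
  define L where "L = fps_to_fls (Abs_fps (\<lambda>n. fls_nth (x (Suc n)) (int n)))"
  have "small (int d) (x d - L)" for d
    unfolding small_def
  proof (intro allI impI)
    fix n assume n: "n < int d"
    show "fls_nth (x d - L) n = 0"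
    proof (cases "n < 0")
      case True
      then show ?thesis using assms(1)[of d] by (simp add: L_def small_def)
    next
      case False
      with n have "fls_nth (x (Suc (nat n) + (d - Suc (nat n))) - x (Suc (nat n))) n = 0"
        using step[of "Suc (nat n)" "d - Suc (nat n)"] unfolding small_def by simp
      then show ?thesis
        using False n by (simp add: L_def)
    qed
  qed
  then have "small N (x d - L)" if "d \<ge> nat N" for N d
    using that by (metis small_mono nat_le_iff)
  then show ?thesis
    unfolding converges_def by blast
qed

section \<open>Graded sequences\<close>

abbreviation (input) ratfuns :: "'a::field fls set" where
  "ratfuns \<equiv> range ratfun_to_fls"

lemma poly_to_fls_ratfuns: "poly_to_fls p \<in> ratfuns"
  using ratfun_to_fls_Fract[of 1 p] by (metis div_by_1 poly_to_fls_1 rangeI zero_neq_one)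

lemma ratfuns_add: "x \<in> ratfuns \<Longrightarrow> y \<in> ratfuns \<Longrightarrow> x + y \<in> ratfuns"
proof -
  assume "x \<in> ratfuns" "y \<in> ratfuns"
  then obtain a b c d where "x = poly_to_fls a / poly_to_fls b" "y = poly_to_fls c / poly_to_fls d"
    "b \<noteq> 0" "d \<noteq> 0" unfolding range_ratfun_to_fls by blast
  then have "x + y = poly_to_fls (a * d + c * b) / poly_to_fls (b * d)" "b * d \<noteq> 0"
    by (simp_all add: poly_to_fls_mult poly_to_fls_add add_frac_eq mult.commute)
  then show ?thesis
    unfolding range_ratfun_to_fls by blast
qed

lemma ratfuns_mult: "x \<in> ratfuns \<Longrightarrow> y \<in> ratfuns \<Longrightarrow> x * y \<in> ratfuns"
proof -
  assume "x \<in> ratfuns" "y \<in> ratfuns"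
  then obtain a b c d where "x = poly_to_fls a / poly_to_fls b" "y = poly_to_fls c / poly_to_fls d"
    "b \<noteq> 0" "d \<noteq> 0" unfolding range_ratfun_to_fls by blast
  then have "x * y = poly_to_fls (a * c) / poly_to_fls (b * d)" "b * d \<noteq> 0"
    by (simp_all add: poly_to_fls_mult)
  then show ?thesis
    unfolding range_ratfun_to_fls by blast
qed

lemma ratfuns_divide: "x \<in> ratfuns \<Longrightarrow> y \<in> ratfuns \<Longrightarrow> x / y \<in> ratfuns"
proof -
  assume "x \<in> ratfuns" "y \<in> ratfuns"
  then obtain a b c d where "x = poly_to_fls a / poly_to_fls b" "y = poly_to_fls c / poly_to_fls d"
    "b \<noteq> 0" "d \<noteq> 0" unfolding range_ratfun_to_fls by blast
  then have *: "x / y = poly_to_fls (a * d) / poly_to_fls (b * c)" "b \<noteq> 0"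
    by (simp_all add: poly_to_fls_mult)
  show ?thesis
  proof (cases "c = 0")
    case True
    then have "x / y = poly_to_fls 0" using * by simp
    then show ?thesis using poly_to_fls_ratfuns by metis
  next
    case False
    then show ?thesis
      using * unfolding range_ratfun_to_fls by (metis (mono_tags, lifting) CollectI mult_eq_0_iff)
  qed
qed

lemma ratfuns_0: "0 \<in> ratfuns" and ratfuns_1: "1 \<in> ratfuns"
  using poly_to_fls_ratfuns[of 0] poly_to_fls_ratfuns[of 1] by simp_all

lemma ratfuns_minus_1: "- 1 \<in> (ratfuns :: 'a::field fls set)"
proof -
  have "poly_to_fls (- 1 :: 'a poly) = - 1"
    using poly_to_fls_add[of 1 "- 1 :: 'a poly"] by (simp add: eq_neg_iff_add_eq_0 add.commute)
  then show "(- 1 :: 'a fls) \<in> ratfuns"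
    using poly_to_fls_ratfuns[of "- 1 :: 'a poly"] by simp
qed

lemma ratfuns_power: "x \<in> ratfuns \<Longrightarrow> x ^ n \<in> ratfuns"
  by (induction n) (auto intro: ratfuns_mult ratfuns_1)

text \<open>Elements of weight \<open>n\<close>, where \<open>\<beta>\<close> has weight \<open>r\<close> and rational functions have weight \<open>0\<close>.\<close>

definition weight :: "nat \<Rightarrow> 'a::field fls \<Rightarrow> nat \<Rightarrow> 'a fls set" where
  "weight r \<beta> n = {x. if r dvd n then \<exists>y\<in>ratfuns. x = \<beta> ^ (n div r) * y else x = 0}"

lemma weight_0: "0 \<in> weight r \<beta> n"
  unfolding weight_def using ratfuns_0 by force

lemma weight_ratfuns: "x \<in> ratfuns \<Longrightarrow> x \<in> weight r \<beta> 0"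
  by (simp add: weight_def)

lemma weight_add: "x \<in> weight r \<beta> n \<Longrightarrow> y \<in> weight r \<beta> n \<Longrightarrow> x + y \<in> weight r \<beta> n"
proof -
  assume xy: "x \<in> weight r \<beta> n" "y \<in> weight r \<beta> n"
  show ?thesis
  proof (cases "r dvd n")
    case True
    then obtain a b where "a \<in> ratfuns" "b \<in> ratfuns" "x = \<beta> ^ (n div r) * a" "y = \<beta> ^ (n div r) * b"
      using xy by (auto simp: weight_def)
    then have "x + y = \<beta> ^ (n div r) * (a + b)" "a + b \<in> ratfuns"
      using ratfuns_add by (auto simp: distrib_left)
    then show ?thesis using True unfolding weight_def by auto
  qed (use xy in \<open>simp add: weight_def\<close>)
qed

lemma weight_mult:
  assumes "x \<in> weight r \<beta> m" "y \<in> weight r \<beta> n"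
  shows "x * y \<in> weight r \<beta> (m + n)"
proof (cases "r dvd m \<and> r dvd n")
  case True
  then obtain a b where "a \<in> ratfuns" "b \<in> ratfuns" "x = \<beta> ^ (m div r) * a" "y = \<beta> ^ (n div r) * b"
    using assms by (auto simp: weight_def)
  then have "x * y = \<beta> ^ ((m + n) div r) * (a * b)" "a * b \<in> ratfuns"
    using True ratfuns_mult by (auto simp: div_plus_div_distrib_dvd_left power_add)
  then show ?thesis using True unfolding weight_def by auto
next
  case False
  then have "x * y = 0"
    using assms by (auto simp: weight_def)
  then show ?thesis by (simp only: weight_0)
qed

text \<open>The identities between generating functions hold at each finite stage \<open>d\<close>,
  but homogeneity appears only in the limit; so a weight is attached to a sequence through its
  limit.\<close>

definition weight_lim :: "nat \<Rightarrow> 'a::field fls \<Rightarrow> nat \<Rightarrow> (nat \<Rightarrow> 'a fls) \<Rightarrow> bool" where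
  "weight_lim r \<beta> n x \<longleftrightarrow> (\<exists>L\<in>weight r \<beta> n. converges x L)"

lemma weight_lim_ratfuns: "c \<in> ratfuns \<Longrightarrow> weight_lim r \<beta> 0 (\<lambda>d. c)"
  unfolding weight_lim_def by (intro bexI[of _ c] weight_ratfuns) simp_all

lemma weight_lim_0: "weight_lim r \<beta> n (\<lambda>d. 0)"
  unfolding weight_lim_def by (intro bexI[of _ 0] weight_0) simp

lemma weight_lim_add:
  "weight_lim r \<beta> n x \<Longrightarrow> weight_lim r \<beta> n y \<Longrightarrow> weight_lim r \<beta> n (\<lambda>d. x d + y d)"
  unfolding weight_lim_def by (blast intro: weight_add converges_add)

lemma weight_lim_mult:
  "weight_lim r \<beta> m x \<Longrightarrow> weight_lim r \<beta> n y \<Longrightarrow> weight_lim r \<beta> (m + n) (\<lambda>d. x d * y d)"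
  unfolding weight_lim_def by (blast intro: weight_mult converges_mult)

lemma weight_lim_mult_ratfun:
  "c \<in> ratfuns \<Longrightarrow> weight_lim r \<beta> n y \<Longrightarrow> weight_lim r \<beta> n (\<lambda>d. c * y d)"
  using weight_lim_mult[OF weight_lim_ratfuns] by fastforce

lemma weight_lim_diff:
  "weight_lim r \<beta> n x \<Longrightarrow> weight_lim r \<beta> n y \<Longrightarrow> weight_lim r \<beta> n (\<lambda>d. x d - y d)"
  using weight_lim_add[OF _ weight_lim_mult_ratfun[OF ratfuns_minus_1], of r \<beta> n x y] by simp

lemma weight_lim_sum:
  "(\<And>i. i \<in> I \<Longrightarrow> weight_lim r \<beta> n (x i)) \<Longrightarrow> weight_lim r \<beta> n (\<lambda>d. \<Sum>i\<in>I. x i d)"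
  by (induction I rule: infinite_finite_induct) (auto intro: weight_lim_add weight_lim_0)

text \<open>As \<open>F\<close> has constant coefficient 1, each coefficient of the quotient
  \<open>A\<close> is that of \<open>B\<close> minus products of earlier ones with coefficients of
  \<open>F\<close>. The shift \<open>s\<close> serves for derivatives: 1 for the first and 2 for the
  second.\<close>

lemma weight_lim_fps_divide:
  fixes A B F :: "nat \<Rightarrow> 'a::field fls fps"
  assumes AF: "\<And>d. A d * F d = B d" and F0: "\<And>d. fps_nth (F d) 0 = 1"
    and F: "\<And>n. weight_lim r \<beta> n (\<lambda>d. fps_nth (F d) n)"
    and B: "\<And>n. weight_lim r \<beta> (n + s) (\<lambda>d. fps_nth (B d) n)"
  shows "weight_lim r \<beta> (n + s) (\<lambda>d. fps_nth (A d) n)"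
proof (induction n rule: less_induct)
  case (less n)
  have eq: "fps_nth (A d) n = fps_nth (B d) n - (\<Sum>i<n. fps_nth (A d) i * fps_nth (F d) (n - i))" for d
  proof -
    have "{0..n} = insert n {..<n}" by auto
    then show ?thesis
      unfolding AF [symmetric] fps_mult_nth by (simp add: F0)
  qed
  have "weight_lim r \<beta> (n + s) (\<lambda>d. fps_nth (A d) i * fps_nth (F d) (n - i))"
    if "i < n" for i
    using weight_lim_mult[OF less[OF that] F[of "n - i"]] that by (simp add: add.commute)
  then have "weight_lim r \<beta> (n + s)
      (\<lambda>d. fps_nth (B d) n - (\<Sum>i<n. fps_nth (A d) i * fps_nth (F d) (n - i)))"
    by (intro weight_lim_diff B weight_lim_sum) simp
  with eq show ?case by simp
qed

section \<open>Power sums\<close>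

text \<open>The divided derivative f''/2, with binomial coefficients in place of the division by 2
  that characteristic two forbids.\<close>

definition hasse2 :: "'b::comm_ring_1 fps \<Rightarrow> 'b fps" where
  "hasse2 f = Abs_fps (\<lambda>n. of_nat ((n + 2) choose 2) * fps_nth f (n + 2))"

text \<open>The expansion of x / (1 - x X), which in characteristic two is the logarithmic
  derivative of 1 + x X.\<close>

definition power_series :: "'b::comm_ring_1 \<Rightarrow> 'b fps" where
  "power_series x = Abs_fps (\<lambda>n. x ^ Suc n)"

lemma power_series_mult:
  assumes "(2::'b::comm_ring_1) = 0"
  shows "power_series x * (1 + fps_const x * fps_X) = fps_const (x::'b)"
proof (rule fps_ext)
  fix n
  have "power_series x * (1 + fps_const x * fps_X) = power_series x + fps_const x * power_series x * fps_X"
    by (simp only: distrib_left mult_1_right mult.assoc mult.left_commute[of "fps_const x"])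
  then show "fps_nth (power_series x * (1 + fps_const x * fps_X)) n = fps_nth (fps_const x) n"
    using char2_add_self[OF assms, of "x * x ^ (n - 1) * x"]
    by (cases n) (simp_all add: power_series_def mult_ac)
qed

text \<open>The Leibniz rule for divided derivatives: the linear factor has first derivative
  \<open>fps_const x\<close> and second one 0.\<close>

lemma hasse2_mult_linear:
  "hasse2 ((1 + fps_const x * fps_X) * g) = (1 + fps_const x * fps_X) * hasse2 g + fps_const x * fps_deriv g"
proof (rule fps_ext)
  fix n
  have "(n + 2) choose 2 = Suc n + ((n + 1) choose 2)"
    by (simp add: numeral_2_eq_2)
  moreover have "(1::nat) choose 2 = 0"
    by simp
  ultimately show "fps_nth (hasse2 ((1 + fps_const x * fps_X) * g)) n =
      fps_nth ((1 + fps_const x * fps_X) * hasse2 g + fps_const x * fps_deriv g) n"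
    by (cases n) (simp_all add: hasse2_def distrib_right mult.assoc algebra_simps binomial_eq_0)
qed

text \<open>Differentiating the product picks one factor for \<open>fps_deriv\<close> and an
  unordered pair of factors for \<open>hasse2\<close>. Dividing by \<open>F A\<close> leaves the
  sum, respectively \<open>esym2\<close>, of the logarithmic derivatives.\<close>

lemma power_series_sum:
  fixes f :: "'a \<Rightarrow> 'b::comm_ring_1"
  assumes "finite A" "(2::'b) = 0"
  defines "F \<equiv> \<lambda>A. \<Prod>a\<in>A. 1 + fps_const (f a) * fps_X"
  shows "(\<Sum>a\<in>A. power_series (f a)) * F A = fps_deriv (F A)"
    and "esym2 (\<lambda>a. power_series (f a)) A * F A = hasse2 (F A)"
proof -
  have "(\<Sum>a\<in>A. power_series (f a)) * F A = fps_deriv (F A) \<and>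
      esym2 (\<lambda>a. power_series (f a)) A * F A = hasse2 (F A)"
    using assms(1)
  proof (induction A)
    case empty
    have "hasse2 (1 :: 'b fps) = 0"
      by (rule fps_ext) (simp add: hasse2_def)
    then show ?case by (simp add: F_def)
  next
    case (insert a A)
    let ?l = "1 + fps_const (f a) * fps_X" and ?S = "\<Sum>a\<in>A. power_series (f a)"
    let ?e = "esym2 (\<lambda>a. power_series (f a)) A"
    have F: "F (insert a A) = ?l * F A"
      using insert by (simp add: F_def)
    have dl: "fps_deriv ?l = fps_const (f a)"
      by simp
    have "(power_series (f a) + ?S) * (?l * F A)
        = (power_series (f a) * ?l) * F A + ?l * (?S * F A)"
      by (simp only: algebra_simps)
    also have "\<dots> = fps_deriv (?l * F A)"
      using insert by (simp only: power_series_mult[OF assms(2)] fps_deriv_mult dl) (simp only: add_ac)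
    finally have 1: "(power_series (f a) + ?S) * (?l * F A) = fps_deriv (?l * F A)" .
    have "(?e + power_series (f a) * ?S) * (?l * F A)
        = ?l * (?e * F A) + (power_series (f a) * ?l) * (?S * F A)"
      by (simp only: algebra_simps)
    also have "\<dots> = hasse2 (?l * F A)"
      using insert by (simp only: power_series_mult[OF assms(2)] hasse2_mult_linear)
    finally have 2: "(?e + power_series (f a) * ?S) * (?l * F A) = hasse2 (?l * F A)" .
    show ?case
      using 1 2 by (simp only: F esym2_insert[OF insert(1,2)] sum.insert[OF insert(1,2)] simp_thms)
  qed
  then show "(\<Sum>a\<in>A. power_series (f a)) * F A = fps_deriv (F A)"
    "esym2 (\<lambda>a. power_series (f a)) A * F A = hasse2 (F A)"
    by auto
qed

lemma sum_symmetric_split: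
  fixes g :: "nat \<Rightarrow> 'b::comm_monoid_add"
  shows "(\<Sum>i=0..2*l. g i) = g l + (\<Sum>i<l. g i + g (2 * l - i))"
proof -
  have "(\<Sum>i=0..2*l. g i) = (\<Sum>i\<in>{..<l} \<union> {l<..2*l} \<union> {l}. g i)"
    by (rule sum.cong) auto
  also have "\<dots> = (\<Sum>i<l. g i) + (\<Sum>i\<in>{l<..2*l}. g i) + g l"
    by (subst sum.union_disjoint, auto)+
  also have "(\<Sum>i\<in>{l<..2*l}. g i) = (\<Sum>i<l. g (2 * l - i))"
    by (rule sum.reindex_bij_witness[of _ "\<lambda>i. 2 * l - i" "\<lambda>i. 2 * l - i"]) auto
  finally show ?thesis
    by (simp add: sum.distrib add_ac)
qed

text \<open>In the coefficient of degree \<open>2 l\<close> the monomials \<open>x\<^sup>a y\<^sup>b\<close> with \<open>a \<noteq> b\<close> sum to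
  \<open>p\<^sub>a p\<^sub>b - p\<^bsub>a+b\<^esub>\<close> in terms of the power sums.\<close>

lemma esym2_power_series_nth:
  fixes f :: "'a \<Rightarrow> 'b::comm_ring_1"
  assumes "finite A" "(2::'b) = 0"
  defines "p \<equiv> \<lambda>A n. \<Sum>a\<in>A. f a ^ n"
  shows "fps_nth (esym2 (\<lambda>a. power_series (f a)) A) (2 * l)
    = esym2 (\<lambda>a. f a ^ Suc l) A + (\<Sum>i<l. p A (Suc i) * p A (Suc (2 * l - i)) + p A (2 * l + 2))"
  using assms(1)
proof (induction A)
  case empty
  then show ?case by (simp add: p_def)
next
  case (insert a A)
  let ?x = "f a"
  have ps: "fps_nth (\<Sum>a\<in>A. power_series (f a)) n = p A (Suc n)" for n
    by (simp add: fps_sum_nth power_series_def p_def)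
  have "fps_nth (power_series ?x * (\<Sum>a\<in>A. power_series (f a))) (2 * l)
      = (\<Sum>i=0..2*l. ?x ^ Suc i * p A (Suc (2 * l - i)))"
    unfolding fps_mult_nth ps by (simp add: power_series_def)
  also have "\<dots> = ?x ^ Suc l * p A (Suc l)
      + (\<Sum>i<l. ?x ^ Suc i * p A (Suc (2 * l - i)) + ?x ^ Suc (2 * l - i) * p A (Suc i))"
    unfolding sum_symmetric_split by (simp add: mult_2)
  finally have 1: "fps_nth (power_series ?x * (\<Sum>a\<in>A. power_series (f a))) (2 * l) = \<dots>" .
  have "p (insert a A) (Suc i) * p (insert a A) (Suc (2 * l - i)) + p (insert a A) (2 * l + 2)
      = (p A (Suc i) * p A (Suc (2 * l - i)) + p A (2 * l + 2))
      + (?x ^ Suc i * p A (Suc (2 * l - i)) + ?x ^ Suc (2 * l - i) * p A (Suc i))" if "i < l" for i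
  proof -
    have pi: "p (insert a A) n = ?x ^ n + p A n" for n
      using insert by (simp add: p_def)
    have XY: "?x ^ Suc i * ?x ^ Suc (2 * l - i) = ?x ^ (2 * l + 2)"
      using that by (simp only: power_add [symmetric]) simp
    \<comment> \<open>Here \<open>X\<close> and \<open>Y\<close> are powers of \<open>f a\<close>,
      and \<open>P\<close>, \<open>Q\<close>, \<open>R\<close> are power sums over the old set. The
      product and the power sum of degree \<open>2 * l + 2\<close> each contribute
      \<open>X * Y\<close>, and these cancel.\<close>
    have "(X + P) * (Y + Q) + (X * Y + R) = (P * Q + R) + (X * Q + Y * P) + (X * Y + X * Y)"
      for X Y P Q R :: 'b
      by (simp add: algebra_simps)
    note id = this[of "?x ^ Suc i" _ "?x ^ Suc (2 * l - i)"]
    show ?thesis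
      unfolding pi XY [symmetric] id char2_add_self[OF assms(2)] by (rule add_0_right)
  qed
  then have 2: "(\<Sum>i<l. p (insert a A) (Suc i) * p (insert a A) (Suc (2 * l - i)) + p (insert a A) (2 * l + 2))
      = (\<Sum>i<l. p A (Suc i) * p A (Suc (2 * l - i)) + p A (2 * l + 2))
      + (\<Sum>i<l. ?x ^ Suc i * p A (Suc (2 * l - i)) + ?x ^ Suc (2 * l - i) * p A (Suc i))"
    by (simp only: sum.distrib [symmetric] cong: sum.cong_simp) simp
  have "p A (Suc l) = (\<Sum>a\<in>A. f a ^ Suc l)"
    by (simp add: p_def)
  then show ?case
    unfolding 2 esym2_insert[OF insert(1,2)] fps_add_nth insert(3) 1
    by (simp only: add_ac)
qed

text \<open>The quotients of the two derivatives by \<open>F\<close> have coefficients of weights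
  \<open>n + 1\<close> and \<open>n + 2\<close>. The first gives the power sums. In the second, for
  \<open>k = Suc l\<close>, the coefficient of degree \<open>2 * l\<close> is the wanted
  \<open>esym2\<close> plus \<open>?R\<close>, an expression in power sums of weight
  \<open>2 * k\<close>.\<close>

lemma weight_lim_power_sums:
  fixes f :: "'b \<Rightarrow> 'a::field fls" and A :: "nat \<Rightarrow> 'b set"
  assumes fin: "\<And>d. finite (A d)" and two: "(2::'a) = 0" and k: "k > 0"
    and F: "\<And>n. weight_lim r \<beta> n (\<lambda>d. coeff (\<Prod>a\<in>A d. [:1, f a:]) n)"
  shows "weight_lim r \<beta> k (\<lambda>d. \<Sum>a\<in>A d. f a ^ k)"
    and "weight_lim r \<beta> (2 * k) (\<lambda>d. esym2 (\<lambda>a. f a ^ k) (A d))"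
proof -
  define F where "F = (\<lambda>A. \<Prod>a\<in>A. 1 + fps_const (f a) * fps_X)"
  have two': "(2::'a fls) = 0" using two by (rule fls_two_eq_0)
  have F_poly: "F A = fps_of_poly (\<Prod>a\<in>A. [:1, f a:])" for A
    by (simp add: F_def fps_of_poly_prod fps_of_poly_linear')
  have F_lim: "weight_lim r \<beta> n (\<lambda>d. fps_nth (F (A d)) n)" for n
    using assms(4) by (simp add: F_poly)
  have F0: "fps_nth (F (A d)) 0 = 1" for d
    using fin by (simp add: F_poly coeff_prod_linear)
  have nat_rat: "(of_nat n :: 'a fls) \<in> ratfuns" for n
    by (induction n) (auto intro: ratfuns_add ratfuns_0 ratfuns_1)
  note ps = power_series_sum[where f = f, folded F_def, OF fin two']
  have 1: "weight_lim r \<beta> (n + 1) (\<lambda>d. fps_nth (fps_deriv (F (A d))) n)" for n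
    unfolding fps_deriv_nth by (intro weight_lim_mult_ratfun nat_rat F_lim)
  have 2: "weight_lim r \<beta> (n + 2) (\<lambda>d. fps_nth (hasse2 (F (A d))) n)" for n
    unfolding hasse2_def fps_nth_Abs_fps by (intro weight_lim_mult_ratfun nat_rat F_lim)
  have P: "weight_lim r \<beta> n (\<lambda>d. \<Sum>a\<in>A d. f a ^ n)" if n: "n > 0" for n
    using weight_lim_fps_divide[OF ps(1) F0 F_lim 1, of "n - 1"] n
    by (simp add: fps_sum_nth power_series_def power_Suc [symmetric] del: power_Suc)
  show "weight_lim r \<beta> k (\<lambda>d. \<Sum>a\<in>A d. f a ^ k)"
    using k by (rule P)
  obtain l where l: "k = Suc l" using k gr0_implies_Suc by blast
  let ?R = "\<lambda>d. \<Sum>i<l. (\<Sum>a\<in>A d. f a ^ Suc i) * (\<Sum>a\<in>A d. f a ^ Suc (2 * l - i)) + (\<Sum>a\<in>A d. f a ^ (2 * l + 2))"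
  have "weight_lim r \<beta> (2 * l + 2) ?R"
  proof (intro weight_lim_sum weight_lim_add)
    fix i assume "i \<in> {..<l}"
    then have "Suc i + Suc (2 * l - i) = 2 * l + 2" by auto
    then show "weight_lim r \<beta> (2 * l + 2) (\<lambda>d. (\<Sum>a\<in>A d. f a ^ Suc i) * (\<Sum>a\<in>A d. f a ^ Suc (2 * l - i)))"
      using weight_lim_mult[OF P[of "Suc i"] P[of "Suc (2 * l - i)"]] by simp
  qed (rule P, simp)
  moreover have "weight_lim r \<beta> (2 * l + 2) (\<lambda>d. fps_nth (esym2 (\<lambda>a. power_series (f a)) (A d)) (2 * l))"
    by (rule weight_lim_fps_divide[OF ps(2) F0 F_lim 2])
  ultimately have "weight_lim r \<beta> (2 * l + 2)
      (\<lambda>d. fps_nth (esym2 (\<lambda>a. power_series (f a)) (A d)) (2 * l) - ?R d)"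
    by (intro weight_lim_diff)
  then show "weight_lim r \<beta> (2 * k) (\<lambda>d. esym2 (\<lambda>a. f a ^ k) (A d))"
    unfolding esym2_power_series_nth[OF fin two'] by (simp add: l del: power_Suc)
qed

section \<open>Finite lattices of polynomials\<close>

lemma coeff_power2_char2:
  fixes p :: "'b::comm_ring_1 poly"
  assumes "(2::'b) = 0"
  shows "coeff (p\<^sup>2) n = (if even n then (coeff p (n div 2))\<^sup>2 else 0)"
proof (induction p arbitrary: n)
  case (pCons a p)
  have "(pCons a p)\<^sup>2 = [:a:]\<^sup>2 + (pCons 0 p)\<^sup>2 + 2 * [:a:] * pCons 0 p"
    by (subst power2_sum [symmetric]) simp
  also have "\<dots> = pCons (a\<^sup>2) (pCons 0 (p\<^sup>2))"
    using poly_two_eq_0[OF assms] by (simp add: power2_eq_square)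
  finally show ?case
    using pCons by (auto simp: coeff_pCons split: nat.split)
qed simp

lemma coeff_power_char2:
  fixes p :: "'b::comm_ring_1 poly"
  assumes "(2::'b) = 0"
  shows "coeff (p ^ 2 ^ m) n = (if 2 ^ m dvd n then coeff p (n div 2 ^ m) ^ 2 ^ m else 0)"
proof (induction m arbitrary: n)
  case (Suc m)
  have "p ^ 2 ^ Suc m = (p ^ 2 ^ m)\<^sup>2"
    by (simp add: power_mult [symmetric] mult.commute)
  then have "coeff (p ^ 2 ^ Suc m) n = (if even n then (coeff (p ^ 2 ^ m) (n div 2))\<^sup>2 else 0)"
    using coeff_power2_char2[OF assms] by simp
  moreover have "2 ^ Suc m dvd n \<longleftrightarrow> even n \<and> 2 ^ m dvd n div 2"
    by (auto elim!: evenE dest: dvd_mult_left)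
  moreover have "n div 2 div 2 ^ m = n div 2 ^ Suc m"
    by (simp add: div_mult2_eq)
  ultimately show ?case
    by (simp add: Suc power_mult [symmetric] mult.commute power_0_left)
qed simp

text \<open>The space of polynomials of degree below \<open>d\<close>, including 0. It is given by
  coefficients, since with \<open>degree 0 = 0\<close> a bound on \<open>degree\<close> would lose 0
  at \<open>d = 0\<close>.\<close>

definition polys_below :: "nat \<Rightarrow> 'a::zero poly set" where
  "polys_below d = {p. \<forall>i\<ge>d. coeff p i = 0}"

lemma polys_below_0: "polys_below 0 = {0}"
  by (auto simp: polys_below_def poly_eq_iff)

lemma polys_below_Suc: "polys_below (Suc d) = (\<lambda>(c, p). pCons c p) ` (UNIV \<times> polys_below d)"
proof (intro equalityI subsetI)
  fix p :: "'a poly" assume p: "p \<in> polys_below (Suc d)"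
  obtain c q where cq: "p = pCons c q" by (cases p)
  then have "q \<in> polys_below d"
    using p by (force simp: polys_below_def coeff_pCons split: nat.splits)
  then show "p \<in> (\<lambda>(c, p). pCons c p) ` (UNIV \<times> polys_below d)"
    using cq by auto
qed (auto simp: polys_below_def coeff_pCons split: nat.splits)

lemma finite_polys_below: "finite (polys_below d :: 'a::{zero, finite} poly set)"
  by (induction d) (simp_all add: polys_below_0 polys_below_Suc)

lemma zero_in_polys_below [simp]: "0 \<in> polys_below d"
  by (simp add: polys_below_def)

lemma polys_below_mono: "d \<le> e \<Longrightarrow> polys_below d \<subseteq> polys_below e"
  by (auto simp: polys_below_def)

lemma polys_below_degree: "p \<in> polys_below d \<Longrightarrow> p \<noteq> 0 \<Longrightarrow> degree p < d"
  unfolding polys_below_def by (metis (mono_tags) leading_coeff_0_iff linorder_not_less mem_Collect_eq)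

lemma degree_polys_below: "degree p < d \<Longrightarrow> p \<in> polys_below d"
  by (auto simp: polys_below_def coeff_eq_0)

section \<open>The polynomial with the lattice as its roots, and its F_q-linearity\<close>

definition lattice_poly :: "nat \<Rightarrow> 'a::field fls poly" where
  "lattice_poly d = (\<Prod>p\<in>polys_below d. [:poly_to_fls p, 1:])"

text \<open>Additivity is demanded as an identity f(X + y) = f(X) + f(y) in X, the form in which
  shifted lattice products occur.\<close>

definition fq_linear :: "'a::field fls poly \<Rightarrow> bool" where
  "fq_linear f \<longleftrightarrow> (\<forall>y. pcompose f [:y, 1:] = f + [:poly f y:]) \<and>
    (\<forall>c y. poly f (fls_const c * y) = fls_const c * poly f y)"

lemma fq_linear_X: "fq_linear [:0, 1:]"
  by (simp add: fq_linear_def pcompose_pCons)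

lemma fq_linear_smult: "fq_linear f \<Longrightarrow> fq_linear (smult a f)"
  by (simp add: fq_linear_def pcompose_smult smult_add_right mult.left_commute)

lemma fq_linear_add: "fq_linear f \<Longrightarrow> fq_linear g \<Longrightarrow> fq_linear (f + g)"
  by (simp add: fq_linear_def pcompose_add distrib_left)

lemma fq_linear_scale:
  assumes "fq_linear f"
  shows "fq_linear (pcompose f [:0, t:])"
proof -
  have "pcompose (pcompose f [:0, t:]) [:y, 1:] = pcompose (pcompose f [:t * y, 1:]) [:0, t:]" for y
    by (simp add: pcompose_assoc [symmetric] pcompose_pCons)
  then show ?thesis
    using assms
    by (simp add: fq_linear_def pcompose_add poly_pcompose mult.commute[of _ t] mult.left_commute[of t])
qed

lemma pcompose_power: "pcompose (f ^ n) g = pcompose f g ^ n"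
  by (induction n) (simp_all add: pcompose_mult pcompose_1)

lemma fq_linear_power:
  fixes f :: "'a::{field, finite} fls poly"
  assumes "fq_linear f" and card: "card (UNIV :: 'a set) = 2 ^ n"
  shows "fq_linear (f ^ 2 ^ n)"
  unfolding fq_linear_def
proof (intro conjI allI)
  have two: "(2 :: 'a fls poly) = 0"
    using two_eq_0_if_card[OF card] by (intro poly_two_eq_0 fls_two_eq_0)
  fix y
  have "[:poly f y:] ^ m = [:poly f y ^ m:]" for m
    by (induction m) simp_all
  then show "pcompose (f ^ 2 ^ n) [:y, 1:] = f ^ 2 ^ n + [:poly (f ^ 2 ^ n) y:]"
    using assms(1) by (simp add: fq_linear_def pcompose_power char2_add_power[OF two])
next
  fix c :: 'a and y :: "'a fls"
  have "fls_const c ^ m = fls_const (c ^ m)" for m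
    by (induction m) simp_all
  then show "poly (f ^ 2 ^ n) (fls_const c * y) = fls_const c * poly (f ^ 2 ^ n) y"
    using assms(1) finite_field_power_card[of c] card
    by (simp add: fq_linear_def power_mult_distrib)
qed

text \<open>For nonzero \<open>w\<close>, dividing by \<open>w\<close> reduces this to
  \<open>finite_field_prod_add\<close> and gives B = w^(q-1); for \<open>w = 0\<close> the product
  is X^q.\<close>

lemma prod_add_fq_multiples:
  fixes w :: "'a::{field, finite} fls"
  assumes card: "card (UNIV :: 'a set) = 2 ^ n"
  shows "\<exists>B. (\<Prod>c\<in>UNIV. X + [:fls_const c * w:]) = X ^ 2 ^ n + smult B X"
proof (cases "w = 0")
  case True
  then show ?thesis
    using card by (intro exI[of _ 0]) simp
next
  case False
  let ?Y = "smult (inverse w) X"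
  have two: "(2 :: 'a fls poly) = 0"
    using two_eq_0_if_card[OF card] by (intro poly_two_eq_0 fls_two_eq_0)
  have pw: "[:fls_const c:] ^ m = [:fls_const (c ^ m):]" for c :: 'a and m
    by (induction m) (simp_all add: mult.commute)
  have "(\<Prod>c\<in>UNIV. ?Y + [:fls_const (c::'a):]) = ?Y ^ 2 ^ n + ?Y"
  proof (rule finite_field_prod_add[OF card _ _ two])
    show "inj (\<lambda>c::'a. [:fls_const c:])"
      by (auto intro!: injI simp: fls_const_nonzero) (metis fls_const_nth)
    show "[:fls_const c:] ^ 2 ^ n = [:fls_const c:]" for c :: 'a
      using finite_field_power_card[of c] card by (simp add: pw)
  qed
  moreover have "X + [:fls_const c * w:] = smult w (?Y + [:fls_const c:])" for c :: 'a
    using False by (simp add: smult_add_right mult.commute)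
  ultimately have "(\<Prod>c\<in>UNIV. X + [:fls_const (c::'a) * w:]) = smult (w ^ 2 ^ n) (?Y ^ 2 ^ n + ?Y)"
    using card by (simp add: prod_smult)
  also have "\<dots> = X ^ 2 ^ n + smult (w ^ 2 ^ n * inverse w) X"
    using False by (simp add: smult_add_right smult_power power_mult_distrib [symmetric])
  finally show ?thesis by blast
qed

text \<open>An element of \<open>polys_below (Suc d)\<close> is c + T p with p in
  \<open>polys_below d\<close>, and T X + c + T p = T ((X + c/T) + p). The product over p is thus a
  shift of \<open>lattice_poly d\<close>, which linearity turns into \<open>lattice_poly d\<close>
  plus c times its value at 1/T; \<open>prod_add_fq_multiples\<close> then takes the product over c.
  This is the finite form of e(T z) = T e(z) + \<beta> e(z)^q.\<close>

lemma lattice_poly_Suc: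
  assumes card: "card (UNIV :: 'a::{field, finite} set) = 2 ^ n"
    and lin: "fq_linear (lattice_poly d :: 'a fls poly)"
  shows "\<exists>A B. pcompose (lattice_poly (Suc d) :: 'a fls poly) [:0, fls_X_inv:] =
    smult A (lattice_poly d ^ 2 ^ n + smult B (lattice_poly d))"
proof -
  let ?T = "fls_X_inv :: 'a fls" and ?V = "polys_below d :: 'a poly set" and ?M = "lattice_poly d :: 'a fls poly"
  have inj: "inj_on (\<lambda>(c, p). pCons c p) (UNIV \<times> ?V)"
    by (auto simp: inj_on_def)
  have T: "?T \<noteq> 0" by simp
  have lin_eq: "[:fls_const c + ?T * x, ?T:] = smult ?T (pcompose [:x, 1:] [:fls_const c * inverse ?T, 1:])"
    for c x
    using T by (simp add: pcompose_pCons distrib_left mult.left_commute[of ?T])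
  have "pcompose (lattice_poly (Suc d)) [:0, ?T:]
      = (\<Prod>(c, p)\<in>UNIV \<times> ?V. [:fls_const c + ?T * poly_to_fls p, ?T:])"
    unfolding lattice_poly_def polys_below_Suc prod.reindex[OF inj] pcompose_prod
    by (rule prod.cong) (auto simp: poly_to_fls_pCons pcompose_pCons)
  also have "\<dots> = (\<Prod>c\<in>UNIV. \<Prod>p\<in>?V. smult ?T (pcompose [:poly_to_fls p, 1:] [:fls_const c * inverse ?T, 1:]))"
    unfolding prod.cartesian_product [symmetric] lin_eq ..
  also have "\<dots> = (\<Prod>c\<in>UNIV. smult (?T ^ card ?V) (?M + [:fls_const c * poly ?M (inverse ?T):]))"
    using lin unfolding prod_smult pcompose_prod [symmetric] lattice_poly_def [symmetric]
    by (simp add: fq_linear_def)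
  also have "\<dots> = smult ((?T ^ card ?V) ^ 2 ^ n) (\<Prod>c\<in>UNIV. ?M + [:fls_const c * poly ?M (inverse ?T):])"
    unfolding prod_smult using card by simp
  finally show ?thesis
    using prod_add_fq_multiples[OF card, of ?M "poly ?M (inverse ?T)"] by metis
qed

text \<open>By the recursion, the next polynomial at T X is a combination of the current one and its
  q-th power; Frobenius, sums and scalings of X preserve linearity.\<close>

lemma fq_linear_lattice_poly:
  assumes card: "card (UNIV :: 'a::{field, finite} set) = 2 ^ n"
  shows "fq_linear (lattice_poly d :: 'a fls poly)"
proof (induction d)
  case 0
  then show ?case
    using fq_linear_X by (simp add: lattice_poly_def polys_below_0)
next
  case (Suc d)
  let ?T = "fls_X_inv :: 'a fls" and ?M = "lattice_poly d :: 'a fls poly"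
  obtain A B where AB: "pcompose (lattice_poly (Suc d)) [:0, ?T:] = smult A (?M ^ 2 ^ n + smult B ?M)"
    using lattice_poly_Suc[OF card Suc] by blast
  have T: "?T \<noteq> 0" by simp
  have "lattice_poly (Suc d) = pcompose (pcompose (lattice_poly (Suc d)) [:0, ?T:]) [:0, inverse ?T:]"
    using T by (simp only: pcompose_assoc [symmetric]) (simp add: pcompose_pCons pcompose_idR)
  also have "fq_linear \<dots>"
    unfolding AB by (intro fq_linear_scale fq_linear_smult fq_linear_add fq_linear_power Suc card)
  finally show ?case .
qed

section \<open>The finite stages of e(z) / z and their coefficients\<close>

definition lattice_prod :: "nat \<Rightarrow> 'a::field fls poly" where
  "lattice_prod d = (\<Prod>p\<in>polys_below d - {0}. [:1, inverse (poly_to_fls p):])"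

lemma lattice_poly_eq_smult:
  "\<exists>C. C \<noteq> 0 \<and> lattice_poly d = smult C (pCons 0 (lattice_prod d :: 'a::{field, finite} fls poly))"
proof -
  let ?V = "polys_below d - {0} :: 'a poly set"
  have fin: "finite ?V"
    using finite_polys_below by blast
  have "lattice_poly d = [:poly_to_fls 0, 1:] * (\<Prod>p\<in>?V. [:poly_to_fls p, 1:])"
    unfolding lattice_poly_def using finite_polys_below by (intro prod.remove) simp_all
  also have "(\<Prod>p\<in>?V. [:poly_to_fls p, 1:]) = (\<Prod>p\<in>?V. smult (poly_to_fls p) [:1, inverse (poly_to_fls p):])"
    by (rule prod.cong) auto
  also have "\<dots> = smult (\<Prod>p\<in>?V. poly_to_fls p) (lattice_prod d)"
    unfolding prod_smult lattice_prod_def ..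
  finally show ?thesis
    using fin by (intro exI[of _ "\<Prod>p\<in>?V. poly_to_fls p"]) simp
qed

lemma coeff_lattice_prod_0: "coeff (lattice_prod d :: 'a::{field, finite} fls poly) 0 = 1"
  unfolding lattice_prod_def by (rule coeff_prod_linear) (simp add: finite_polys_below)

text \<open>The recursion for \<open>lattice_poly\<close>, compared coefficientwise after
  normalising. The coefficient of degree 1 is always 1, which forces the factor T in front of
  \<open>e d i\<close>; \<alpha> is the remaining constant and depends on \<open>d\<close>.\<close>

lemma lattice_prod_Suc:
  assumes card: "card (UNIV :: 'a::{field, finite} set) = 2 ^ n" and n: "n > 0"
  defines "e \<equiv> \<lambda>d. coeff (pCons 0 (lattice_prod d :: 'a fls poly))"
  shows "\<exists>\<alpha>. \<forall>i. fls_X_inv ^ i * e (Suc d) i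
    = fls_X_inv * e d i + (if 2 ^ n dvd i then \<alpha> * e d (i div 2 ^ n) ^ 2 ^ n else 0)"
proof -
  let ?T = "fls_X_inv :: 'a fls" and ?q = "2 ^ n :: nat"
  have two: "(2 :: 'a fls) = 0"
    using two_eq_0_if_card[OF card] by (rule fls_two_eq_0)
  obtain A B where AB: "pcompose (lattice_poly (Suc d)) [:0, ?T:] =
      smult A (lattice_poly d ^ ?q + smult B (lattice_poly d))"
    using lattice_poly_Suc[OF card fq_linear_lattice_poly[OF card]] by blast
  obtain C where C: "lattice_poly d = smult C (pCons 0 (lattice_prod d :: 'a fls poly))"
    using lattice_poly_eq_smult by blast
  obtain C' where C': "C' \<noteq> 0" "lattice_poly (Suc d) = smult C' (pCons 0 (lattice_prod (Suc d) :: 'a fls poly))"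
    using lattice_poly_eq_smult by blast
  have eq: "?T ^ i * (C' * e (Suc d) i)
      = A * ((if ?q dvd i then (C * e d (i div ?q)) ^ ?q else 0) + B * (C * e d i))" for i
    using arg_cong[OF AB, of "\<lambda>p. coeff p i"] unfolding coeff_pcompose_linear coeff_smult coeff_add
      coeff_power_char2[OF two] C C'(2) e_def .
  have e1: "e d 1 = 1" for d
    by (simp add: e_def coeff_lattice_prod_0)
  \<comment> \<open>In degree 1 only the linear term contributes, as q > 1.\<close>
  have "\<not> ?q dvd 1"
    using n by simp
  then have ABC: "?T * C' = A * (B * C)"
    using eq[of 1] e1 by simp
  have "?T ^ i * e (Suc d) i = ?T * e d i
      + (if ?q dvd i then A * C ^ ?q / C' * e d (i div ?q) ^ ?q else 0)" for i
  proof -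
    have "C' * (?T ^ i * e (Suc d) i)
        = A * (if ?q dvd i then (C * e d (i div ?q)) ^ ?q else 0) + (A * (B * C)) * e d i"
      using eq[of i] by (simp only: distrib_left mult_ac)
    also have "\<dots> = C' * (?T * e d i
      + (if ?q dvd i then A * C ^ ?q / C' * e d (i div ?q) ^ ?q else 0))"
      unfolding ABC [symmetric] using C'(1)
      by (simp add: distrib_left power_mult_distrib mult_ac)
    finally show ?thesis
      using C'(1) by (simp only: mult_cancel_left) simp
  qed
  then show ?thesis by blast
qed

text \<open>Passing from \<open>d\<close> to \<open>Suc d\<close> adds only polynomials of degree
  \<open>d\<close>, whose inverses have order \<open>d\<close>.\<close>

lemma lattice_prod_converges:
  "\<exists>L. converges (\<lambda>d. coeff (lattice_prod d :: 'a::{field, finite} fls poly) i) L"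
proof (rule converges_if_small_steps)
  let ?f = "\<lambda>p :: 'a poly. inverse (poly_to_fls p)"
  have f: "small (int (degree p)) (?f p)" for p
    using small_subdegree[of "?f p"] by (simp add: fls_subdegree_poly_to_fls)
  then have f0: "small 0 (?f p)" for p
    by (rule small_mono) simp
  fix d
  have fin: "finite (polys_below d - {0} :: 'a poly set)" for d
    by (simp add: finite_polys_below)
  have "small 0 (coeff 1 i :: 'a fls)"
    by (cases i) simp_all
  moreover have "small 0 (coeff (lattice_prod d :: 'a fls poly) i - coeff 1 i)"
    using small_coeff_prod_diff[OF fin[of d], of "{}" ?f 0 i] f0 by (simp add: lattice_prod_def)
  ultimately show "small 0 (coeff (lattice_prod d :: 'a fls poly) i)"
    using small_add by fastforce
  have "small (int d) (?f p)" if "p \<in> (polys_below (Suc d) - {0}) - (polys_below d - {0})" for p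
    using that degree_polys_below[of p d] by (intro small_mono[OF f]) force
  then show "small (int d) (coeff (lattice_prod (Suc d) :: 'a fls poly) i - coeff (lattice_prod d) i)"
    unfolding lattice_prod_def using polys_below_mono[of d "Suc d"]
    by (intro small_coeff_prod_diff fin f0) auto
qed

text \<open>In the limit the recursion reads (T^i - T) c_i = \<beta> c_(i/q)^q, with right side 0
  unless q divides i. The weight of c_(i+1) is i because i = (q - 1) + q j when i + 1 = q (j + 1):
  one new factor \<beta>, and the q-th power of an element of weight j.\<close>

lemma lattice_prod_weight:
  assumes card: "card (UNIV :: 'a::{field, finite} set) = 2 ^ n" and n: "n > 0"
  shows "\<exists>\<beta>. \<forall>i. weight_lim (2 ^ n - 1) \<beta> i (\<lambda>d. coeff (lattice_prod d :: 'a fls poly) i)"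
proof -
  let ?T = "fls_X_inv :: 'a fls" and ?q = "2 ^ n :: nat"
  define e where "e = (\<lambda>d. coeff (pCons 0 (lattice_prod d :: 'a fls poly)))"
  have q: "?q > 1"
    using n by (intro one_less_power) simp_all
  obtain \<alpha> where \<alpha>: "\<And>d i. ?T ^ i * e (Suc d) i
      = ?T * e d i + (if ?q dvd i then \<alpha> d * e d (i div ?q) ^ ?q else 0)"
    using lattice_prod_Suc[OF card n] unfolding e_def by metis
  have "\<exists>L. converges (\<lambda>d. e d i) L" for i
  proof (cases i)
    case 0
    then show ?thesis by (intro exI[of _ 0]) (simp add: e_def)
  qed (simp add: e_def lattice_prod_converges)
  then obtain c where c: "\<And>i. converges (\<lambda>d. e d i) (c i)"
    by metis
  have e1: "e d 1 = 1" for d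
    by (simp add: e_def coeff_lattice_prod_0)
  have "converges (\<lambda>d. e d 1) 1"
    unfolding e1 by simp
  with c have c1: "c 1 = 1"
    by (rule converges_unique)
  define \<beta> where "\<beta> = ?T ^ ?q * c ?q - ?T * c ?q"
  \<comment> \<open>The recursion in degree q, where \<open>e d 1 = 1\<close>, determines \<alpha>;
    hence \<alpha> converges, with limit \<beta>.\<close>
  have "\<alpha> = (\<lambda>d. ?T ^ ?q * e (Suc d) ?q - ?T * e d ?q)"
    using \<alpha>[of ?q] e1 by (auto simp: fun_eq_iff)
  then have \<beta>: "converges \<alpha> \<beta>"
    unfolding \<beta>_def by (auto intro!: converges_diff converges_mult converges_const converges_Suc c)
  have rec: "?T ^ i * c i = ?T * c i + (if ?q dvd i then \<beta> * c (i div ?q) ^ ?q else 0)" for i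
  proof (rule converges_unique)
    show "converges (\<lambda>d. ?T ^ i * e (Suc d) i) (?T ^ i * c i)"
      by (intro converges_mult converges_const converges_Suc c)
    show "converges (\<lambda>d. ?T ^ i * e (Suc d) i) (?T * c i + (if ?q dvd i then \<beta> * c (i div ?q) ^ ?q else 0))"
      unfolding \<alpha> by (auto intro!: converges_add converges_mult converges_power c \<beta>)
  qed
  have "c (Suc i) \<in> weight (?q - 1) \<beta> i" for i
  proof (induction i rule: less_induct)
    case (less i)
    show ?case
    proof (cases "i = 0")
      case True
      then show ?thesis
        using c1 by (simp add: weight_ratfuns ratfuns_1)
    next
      case False
      let ?D = "?T ^ Suc i - ?T"
      \<comment> \<open>Distinct powers of T have distinct valuations, so the recursion can be
        solved for \<open>c (Suc i)\<close>.\<close>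
      have "fls_subdegree (?T ^ Suc i) \<noteq> fls_subdegree ?T"
        using False unfolding fls_subdegree_fls_X_inv_pow by simp
      then have D: "?D \<noteq> 0"
        by (metis right_minus_eq)
      have "?T \<in> ratfuns"
        using poly_to_fls_ratfuns[of "[:0, 1:]"] by (simp only: poly_to_fls_T)
      then have "?T ^ Suc i + (- 1) * ?T \<in> ratfuns"
        by (intro ratfuns_add ratfuns_mult ratfuns_power ratfuns_minus_1)
      then have D': "1 / ?D \<in> ratfuns"
        by (intro ratfuns_divide ratfuns_1) simp
      define R where "R = (if ?q dvd Suc i then \<beta> * c (Suc i div ?q) ^ ?q else 0)"
      have "?D * c (Suc i) = R"
        using rec[of "Suc i"] unfolding R_def [symmetric] left_diff_distrib by simp
      then have "c (Suc i) = R * (1 / ?D)"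
        unfolding times_divide_eq_right using D by (metis mult_1_right nonzero_mult_div_cancel_left)
      then have ci: "c (Suc i) = (if ?q dvd Suc i then \<beta> * c (Suc i div ?q) ^ ?q else 0) * (1 / ?D)"
        unfolding R_def .
      show ?thesis
      proof (cases "?q dvd Suc i")
        case False
        then show ?thesis
          using ci by (simp add: weight_0)
      next
        case True
        then obtain j' where "Suc i = ?q * j'" ..
        moreover from this obtain j where "j' = Suc j"
          by (cases j') auto
        ultimately have j: "Suc i = ?q * Suc j" by simp
        have "1 * Suc j < ?q * Suc j"
          using q by (intro mult_strict_right_mono) simp_all
        then have "j < i"
          using j by simp
        have wp: "x ^ m \<in> weight (?q - 1) \<beta> (m * j)" if "x \<in> weight (?q - 1) \<beta> j" for x m
          using that by (induction m) (auto intro: weight_mult weight_ratfuns ratfuns_1)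
        have "\<beta> \<in> weight (?q - 1) \<beta> (?q - 1)"
          using q ratfuns_1 by (auto simp: weight_def intro!: bexI[of _ 1])
        then have "\<beta> * c (Suc j) ^ ?q * (1 / ?D) \<in> weight (?q - 1) \<beta> ((?q - 1) + ?q * j + 0)"
          by (intro weight_mult wp less[OF \<open>j < i\<close>] weight_ratfuns D')
        moreover have "(?q - 1) + ?q * j + 0 = i"
          using j q by (simp add: algebra_simps)
        moreover have "Suc i div ?q = Suc j"
          using j q by (simp only: nonzero_mult_div_cancel_left)
        ultimately show ?thesis
          using ci True by simp
      qed
    qed
  qed
  then have "weight_lim (?q - 1) \<beta> i (\<lambda>d. coeff (lattice_prod d :: 'a fls poly) i)" for i
    using c[of "Suc i"] by (auto simp: weight_lim_def e_def)
  then show ?thesis by blast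
qed

section \<open>Summation over the irreducible polynomials\<close>

definition monics_below :: "nat \<Rightarrow> 'a::field poly set" where
  "monics_below d = {p \<in> polys_below d. lead_coeff p = 1}"

lemma finite_monics_below: "finite (monics_below d :: 'a::{field, finite} poly set)"
  unfolding monics_below_def by (rule finite_subset[OF _ finite_polys_below[of d]]) auto

text \<open>Every nonzero polynomial is uniquely a unit times a monic one, and c^k = 1 for units c
  since q - 1 divides k. So the family is the monic one times q - 1 copies of 1, whose sum is 1 in
  characteristic two.\<close>

lemma zterm_unit_multiples:
  fixes d :: nat
  assumes card: "card (UNIV :: 'a::{field, finite} set) = 2 ^ n" and n: "n > 0"
    and k: "(2 ^ n - 1) dvd k"
  defines "U \<equiv> monics_below d :: 'a poly set" and "V \<equiv> polys_below d - {0} :: 'a poly set"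
  shows "sum (zterm k) V = sum (zterm k) U"
    and "esym2 (zterm k) V
      = esym2 (zterm k) U + (sum (zterm k) U)\<^sup>2 * esym2 (\<lambda>_. 1) (UNIV - {0 :: 'a})"
proof -
  let ?C = "UNIV - {0 :: 'a}" and ?m = "\<lambda>(a, c). smult c a"
  have two: "(2 :: 'a fls) = 0"
    using two_eq_0_if_card[OF card] by (rule fls_two_eq_0)
  have finU: "finite U"
    unfolding U_def by (rule finite_monics_below)
  have V: "V = ?m ` (U \<times> ?C)"
  proof (intro equalityI subsetI)
    fix p assume p: "p \<in> V"
    then have "(smult (inverse (lead_coeff p)) p, lead_coeff p) \<in> U \<times> ?C"
      by (auto simp: U_def V_def monics_below_def polys_below_def)
    moreover have "p = ?m (smult (inverse (lead_coeff p)) p, lead_coeff p)"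
      using p by (simp add: V_def)
    ultimately show "p \<in> ?m ` (U \<times> ?C)" by blast
  qed (auto simp: U_def V_def monics_below_def polys_below_def)
  have inj: "inj_on ?m (U \<times> ?C)"
  proof (rule inj_onI)
    fix x y assume "x \<in> U \<times> ?C" "y \<in> U \<times> ?C" and eq: "?m x = ?m y"
    then obtain a c b e where *: "x = (a, c)" "y = (b, e)" "lead_coeff a = 1" "lead_coeff b = 1" "c \<noteq> 0"
      by (auto simp: U_def monics_below_def)
    with eq have "smult c a = smult e b" by simp
    moreover from arg_cong[OF this, of lead_coeff] * have "c = e" by simp
    ultimately have "smult c (a - b) = 0" by (simp add: smult_diff_right)
    with * \<open>c = e\<close> show "x = y" by simp
  qed
  have unit: "c ^ k = 1" if "c \<noteq> 0" for c :: 'a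
  proof -
    have "(2 ^ n - 1 :: nat) + 1 = 2 ^ n" by simp
    then have "c ^ (2 ^ n - 1) * c = c"
      using finite_field_power_card[of c] card by (metis power_add power_one_right)
    then have "c ^ (2 ^ n - 1) = 1" using that by simp
    then show ?thesis using k by (auto simp: power_mult elim!: dvdE)
  qed
  have cpow: "fls_const c ^ m = fls_const (c ^ m)" for c :: 'a and m
    by (induction m) simp_all
  have h: "zterm k (smult c a) = zterm k a * 1" if "a \<in> U" "c \<in> ?C" for a c
    using that unit[of c] by (simp add: zterm_def poly_to_fls_smult power_mult_distrib cpow)
  have one: "(\<Sum>c\<in>?C. 1) = (1 :: 'a fls)"
  proof -
    have "(\<Sum>c\<in>insert (0::'a) ?C. 1) = (of_nat (card (UNIV :: 'a set)) :: 'a fls)"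
      by (simp add: insert_absorb)
    then have "1 + (\<Sum>c\<in>?C. 1) = (0 :: 'a fls)"
      using card two n by (subst (asm) sum.insert) simp_all
    then show ?thesis
      using char2_uminus[OF two, of 1] by (metis minus_unique)
  qed
  note im = esym2_image_Times[where m = "\<lambda>a c. smult c a" and f = "zterm k" and g = "\<lambda>_. 1"
      and h = "zterm k", OF finU _ two inj h]
  show "sum (zterm k) V = sum (zterm k) U"
    unfolding V using im(2) one by simp
  show "esym2 (zterm k) V
      = esym2 (zterm k) U + (sum (zterm k) U)\<^sup>2 * esym2 (\<lambda>_. 1) ?C"
    unfolding V using im(1) unfolding one by simp
qed

text \<open>Over the nonzero polynomials the two limits are rational multiples of \<beta>^(k/(q-1))
  and of its square, so \<beta> cancels in the quotient. Passing to monics only subtracts the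
  rational constant \<epsilon>.\<close>

lemma zterm_limits:
  assumes card: "card (UNIV :: 'a::{field, finite} set) = 2 ^ n" and n: "n > 0"
    and k: "(2 ^ n - 1) dvd k" "k > 0"
  shows "\<exists>L1 L2. converges (\<lambda>d. sum (zterm k) (monics_below d :: 'a poly set)) L1 \<and>
    converges (\<lambda>d. esym2 (zterm k) (monics_below d :: 'a poly set)) L2 \<and>
    small 1 (L1 - 1) \<and> L2 / L1\<^sup>2 \<in> ratfuns"
proof -
  let ?V = "\<lambda>d. polys_below d - {0} :: 'a poly set" and ?U = "\<lambda>d. monics_below d :: 'a poly set"
  let ?r = "2 ^ n - 1 :: nat" and ?f = "\<lambda>p :: 'a poly. inverse (poly_to_fls p)"
  obtain \<beta> where \<beta>: "\<And>i. weight_lim ?r \<beta> i (\<lambda>d. coeff (\<Prod>p\<in>?V d. [:1, ?f p:]) i)"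
    using lattice_prod_weight[OF card n] unfolding lattice_prod_def by blast
  have fin: "finite (?V d)" for d
    by (simp add: finite_polys_below)
  have z: "(\<lambda>p. ?f p ^ k) = zterm k"
    by (simp add: zterm_def fun_eq_iff power_inverse)
  define \<epsilon> where "\<epsilon> = (esym2 (\<lambda>_. 1) (UNIV - {0 :: 'a}) :: 'a fls)"
  have "esym2 (\<lambda>_. 1) A \<in> (ratfuns :: 'a fls set)" if "finite A" for A :: "'a set"
    using that
  proof (induction A)
    case (insert a A)
    have "(\<Sum>a\<in>B. 1) \<in> (ratfuns :: 'a fls set)" for B :: "'a set"
      by (induction B rule: infinite_finite_induct)
        (simp_all only: sum.infinite sum.empty sum.insert ratfuns_0 ratfuns_1 ratfuns_add not_False_eq_True)
    then show ?case
      unfolding esym2_insert[OF insert(1,2)] mult_1 by (intro ratfuns_add insert)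
  qed (simp add: ratfuns_0)
  then have \<epsilon>: "\<epsilon> \<in> ratfuns"
    by (simp add: \<epsilon>_def)
  note ws = weight_lim_power_sums[where A = ?V and f = ?f, OF fin two_eq_0_if_card[OF card] k(2) \<beta>]
  obtain L1 where L1: "L1 \<in> weight ?r \<beta> k" "converges (\<lambda>d. sum (zterm k) (?V d)) L1"
    using ws(1) unfolding weight_lim_def z by (auto simp: zterm_def power_inverse)
  obtain L where L: "L \<in> weight ?r \<beta> (2 * k)" "converges (\<lambda>d. esym2 (zterm k) (?V d)) L"
    using ws(2) unfolding weight_lim_def z by blast
  note um = zterm_unit_multiples[OF card n k(1)]
  have c1: "converges (\<lambda>d. sum (zterm k) (?U d)) L1"
    using L1(2) unfolding um(1) .
  have "converges (\<lambda>d. esym2 (zterm k) (?V d) - (sum (zterm k) (?U d))\<^sup>2 * \<epsilon>) (L - L1\<^sup>2 * \<epsilon>)"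
    by (intro converges_diff L converges_mult converges_power c1 converges_const)
  then have c2: "converges (\<lambda>d. esym2 (zterm k) (?U d)) (L - L1\<^sup>2 * \<epsilon>)"
    unfolding um(2) \<epsilon>_def by simp
  \<comment> \<open>Among the monics only 1 has degree 0; every other term has order at least
    1.\<close>
  have "small 1 (sum (zterm k) (?U d) - 1)" if "d \<ge> 1" for d
  proof -
    have "1 \<in> ?U d"
      using that by (auto simp: monics_below_def intro: degree_polys_below)
    moreover have "small 1 (zterm k p)" if p: "p \<in> ?U d - {1}" for p
    proof -
      have "degree p > 0"
        using p by (intro Nat.gr0I) (auto simp: monics_below_def elim!: degree_eq_zeroE)
      then have "1 \<le> int k * int (degree p)"
        using k(2) by (simp flip: of_nat_mult)
      then show ?thesis
        by (rule small_mono[OF small_zterm])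
    qed
    ultimately have "small 1 (sum (zterm k) (?U d) - sum (zterm k) {1})"
      by (intro small_esym2_diff finite_monics_below small_zterm_0) auto
    then show ?thesis by simp
  qed
  then have s1: "small 1 (L1 - 1)"
    by (rule converges_small[OF converges_diff[OF c1 converges_const]])
  then have nz: "L1 \<noteq> 0"
    by (rule small_inverse_unit)
  obtain y1 where y1: "y1 \<in> ratfuns" "L1 = \<beta> ^ (k div ?r) * y1"
    using L1(1) k(1) by (auto simp: weight_def)
  obtain y2 where y2: "y2 \<in> ratfuns" "L = \<beta> ^ (2 * k div ?r) * y2"
    using L(1) k(1) by (auto simp: weight_def)
  have "2 * k div ?r = (k div ?r) * 2"
    using k(1) by (simp add: div_mult_swap mult.commute)
  then have "L = (\<beta> ^ (k div ?r))\<^sup>2 * y2"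
    using y2(2) by (simp only: power_mult)
  \<comment> \<open>This power of \<beta> may be cancelled because it divides out of
    \<open>L1\<close>, which is a one-unit.\<close>
  moreover have "(\<beta> ^ (k div ?r))\<^sup>2 \<noteq> 0"
    using nz unfolding y1(2) by (metis mult_eq_0_iff power_eq_0_iff)
  ultimately have "L / L1\<^sup>2 = y2 / y1\<^sup>2"
    by (simp only: y1(2) power_mult_distrib mult_divide_mult_cancel_left not_False_eq_True)
  then have "L / L1\<^sup>2 \<in> ratfuns"
    using y1(1) y2(1) by (simp add: ratfuns_divide ratfuns_power)
  moreover have "(L - L1\<^sup>2 * \<epsilon>) / L1\<^sup>2 = L / L1\<^sup>2 + (- 1) * \<epsilon>"
    using nz by (simp add: diff_divide_distrib)
  ultimately have "(L - L1\<^sup>2 * \<epsilon>) / L1\<^sup>2 \<in> ratfuns"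
    using \<epsilon> by (simp only: ratfuns_add ratfuns_mult ratfuns_minus_1)
  then show ?thesis
    using c1 c2 s1 by blast
qed

section \<open>Summability and the value of the sum\<close>

lemma dist_le_if_small:
  fixes x y :: "'a::comm_ring_1 fls"
  assumes "small (int N) (x - y)"
  shows "dist x y \<le> (1 / 2) ^ N"
proof (cases "x = y")
  case False
  then have *: "int N \<le> fls_subdegree (x - y)"
    using assms by (simp add: small_iff_subdegree)
  then have "(1 / 2 :: real) ^ nat (fls_subdegree (x - y)) \<le> (1 / 2) ^ N"
    by (intro power_decreasing) auto
  then show ?thesis
    using False * by (simp add: dist_fls_def power_divide inverse_eq_divide)
qed simp

text \<open>Both the set \<open>M\<close> of \<open>supported_esym2\<close> and
  \<open>monics_below d\<close> consist of monics and contain all those of degree at most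
  \<open>N\<close>; whatever else they contain has terms of order at least \<open>N\<close>. So the
  congruence for \<open>M\<close> carries over.\<close>

lemma small_sum_irreducibles:
  fixes S :: "'a::{field, finite} poly set"
  assumes S: "finite S" "S \<subseteq> monic_irreducibles" "\<And>P. P \<in> monic_irreducibles \<Longrightarrow> degree P \<le> N \<Longrightarrow> P \<in> S"
    and k: "k > 0" and two: "(2::'a) = 0" and d: "d > N"
  shows "small (int N) (esym2 (zterm k) (monics_below d)
    + (sum (zterm k) (monics_below d))\<^sup>2 * (\<Sum>P\<in>S. 1 / (poly_to_fls P ^ k - 1)))"
proof -
  let ?U = "monics_below :: nat \<Rightarrow> 'a poly set" and ?h = "\<Sum>P\<in>S. 1 / (poly_to_fls P ^ k - 1)"
  obtain M where M: "finite M" "\<And>m. m \<in> M \<Longrightarrow> supported S m"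
    "\<And>a. supported S a \<Longrightarrow> degree a \<le> N \<Longrightarrow> a \<in> M"
    "small (int N + 1) (esym2 (zterm k) M + (sum (zterm k) M)\<^sup>2 * ?h)"
    using supported_esym2[OF S(1,2) k two, of N] by blast
  have close: "small (int N) (esym2 (zterm k) B - esym2 (zterm k) (?U (Suc N)))"
    "small (int N) (sum (zterm k) B - sum (zterm k) (?U (Suc N)))"
    if B: "finite B" "?U (Suc N) \<subseteq> B" "\<And>p. p \<in> B \<Longrightarrow> lead_coeff p = 1" for B
  proof -
    have "small (int N) (zterm k p)" if "p \<in> B - ?U (Suc N)" for p
    proof -
      have "\<not> degree p < Suc N"
        using that B(3) degree_polys_below by (auto simp: monics_below_def)
      then have "int N \<le> 1 * int (degree p)"
        by simp
      also have "\<dots> \<le> int k * int (degree p)"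
        using k by (intro mult_right_mono) simp_all
      finally show ?thesis
        by (rule small_mono[OF small_zterm])
    qed
    then show "small (int N) (esym2 (zterm k) B - esym2 (zterm k) (?U (Suc N)))"
      "small (int N) (sum (zterm k) B - sum (zterm k) (?U (Suc N)))"
      by (intro small_esym2_diff B small_zterm_0; simp)+
  qed
  have "?U (Suc N) \<subseteq> M"
  proof
    fix a assume a: "a \<in> ?U (Suc N)"
    then have "a \<noteq> 0"
      by (auto simp: monics_below_def)
    moreover from this a have "degree a \<le> N"
      using polys_below_degree[of a "Suc N"] by (simp add: monics_below_def)
    moreover have "degree P \<le> degree a" if "P dvd a" for P
      using that \<open>a \<noteq> 0\<close> by (rule dvd_imp_degree_le)
    ultimately show "a \<in> M"
      using a S(3) by (intro M(3)) (auto simp: supported_def monics_below_def intro: order_trans)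
  qed
  then have cM: "small (int N) (esym2 (zterm k) M - esym2 (zterm k) (?U (Suc N)))"
    "small (int N) (sum (zterm k) M - sum (zterm k) (?U (Suc N)))"
    using close[OF M(1)] M(2) by (auto simp: supported_def)
  have "?U (Suc N) \<subseteq> ?U d"
    using polys_below_mono[of "Suc N" d] d by (auto simp: monics_below_def)
  then have cU: "small (int N) (esym2 (zterm k) (?U d) - esym2 (zterm k) (?U (Suc N)))"
    "small (int N) (sum (zterm k) (?U d) - sum (zterm k) (?U (Suc N)))"
    by (rule close[OF finite_monics_below]; simp add: monics_below_def)+
  have e: "small (int N) (esym2 (zterm k) (?U d) - esym2 (zterm k) M)"
    using small_diff[OF cU(1) cM(1)] by simp
  have s: "small (int N) (sum (zterm k) (?U d) - sum (zterm k) M)"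
    using small_diff[OF cU(2) cM(2)] by simp
  have s0: "small 0 (sum (zterm k) B)" for B :: "'a poly set"
    by (intro small_sum small_zterm_0)
  have h0: "small 0 ?h"
  proof (rule small_sum)
    fix P assume "P \<in> S"
    then have P: "P \<in> monic_irreducibles" using S by blast
    \<comment> \<open>With \<open>R = 0\<close> the family is the single term 1, so
      \<open>small_single_prime\<close> bounds the summand itself.\<close>
    have "esym2 (\<lambda>j. zterm k P ^ j) (insert (0::nat) {}) = 0"
      by (subst esym2_insert) simp_all
    then show "small 0 (1 / (poly_to_fls P ^ k - 1))"
      using small_single_prime[OF P k two, of 0] by (auto intro: small_mono)
  qed
  \<comment> \<open>The change in the squared sum is a difference of squares, small through its
    first factor.\<close>
  have "small (int N) ((sum (zterm k) (?U d) - sum (zterm k) M) * (sum (zterm k) (?U d) + sum (zterm k) M) * ?h)"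
    by (intro small_mult_right s h0 small_add s0)
  moreover have "small (int N) (esym2 (zterm k) M + (sum (zterm k) M)\<^sup>2 * ?h)"
    using M(4) by (rule small_mono) simp
  ultimately have "small (int N) ((esym2 (zterm k) (?U d) - esym2 (zterm k) M)
      + ((sum (zterm k) (?U d) - sum (zterm k) M) * (sum (zterm k) (?U d) + sum (zterm k) M) * ?h
      + (esym2 (zterm k) M + (sum (zterm k) M)\<^sup>2 * ?h)))"
    by (rule small_add[OF e small_add])
  moreover have "(x - y) + ((u - v) * (u + v) * w + (y + v\<^sup>2 * w)) = x + u\<^sup>2 * w"
    for x y u v w :: "'a fls"
    by (simp add: algebra_simps power2_eq_square)
  ultimately show ?thesis
    by (simp only:)
qed

theorem theorem1p1:
  fixes q k :: nat
  assumes "\<exists>n. q = 2 ^ n"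
    and "card (UNIV :: 'a::{field, finite} set) = q"
    and "k > 0"
    and "[k = 0] (mod (q - 1))"
  shows "(\<lambda>P :: 'a poly. 1 / (poly_to_fls P ^ k - 1)) summable_on monic_irreducibles
    \<and> (\<Sum>\<^sub>\<infinity>P :: 'a poly \<in> monic_irreducibles. 1 / (poly_to_fls P ^ k - 1))
        \<in> range ratfun_to_fls"
proof -
  let ?h = "\<lambda>P :: 'a poly. 1 / (poly_to_fls P ^ k - 1)" and ?I = "monic_irreducibles :: 'a poly set"
  let ?U = "monics_below :: nat \<Rightarrow> 'a poly set"
  obtain n where q: "q = 2 ^ n"
    using assms(1) by blast
  with assms(2) have card: "card (UNIV :: 'a set) = 2 ^ n"
    by simp
  then have n: "n > 0"
    by (rule exponent_pos_if_card)
  have two: "(2 :: 'a) = 0"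
    using card by (rule two_eq_0_if_card)
  then have two': "(2 :: 'a fls) = 0"
    by (rule fls_two_eq_0)
  have k: "(2 ^ n - 1) dvd k"
    using assms(4) by (simp add: q cong_0_iff)
  obtain L1 L2 where L: "converges (\<lambda>d. sum (zterm k) (?U d)) L1"
      "converges (\<lambda>d. esym2 (zterm k) (?U d)) L2" "small 1 (L1 - 1)" "L2 / L1\<^sup>2 \<in> ratfuns"
    using zterm_limits[OF card n k assms(3)] by blast
  note unit = small_inverse_unit[OF L(3)]
  \<comment> \<open>The value of the sum: the congruences give \<open>- L2 / L1\<^sup>2\<close>, and
    characteristic two removes the sign.\<close>
  define s where "s = L2 / L1\<^sup>2"
  \<comment> \<open>Valid for every finite \<open>S\<close> that contains the irreducibles of degree
    at most \<open>N\<close>, which is what convergence along finite subsets requires.\<close>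
  have small_sum_s: "small (int N) (sum ?h S - s)"
    if S: "finite S" "S \<subseteq> ?I" "\<And>P. P \<in> ?I \<Longrightarrow> degree P \<le> N \<Longrightarrow> P \<in> S" for N S
  proof -
    have "converges (\<lambda>d. esym2 (zterm k) (?U d) + (sum (zterm k) (?U d))\<^sup>2 * sum ?h S)
        (L2 + L1\<^sup>2 * sum ?h S)"
      by (intro converges_add converges_mult converges_power converges_const L)
    then have "small (int N) (L2 + L1\<^sup>2 * sum ?h S)"
      using small_sum_irreducibles[OF S assms(3) two] by (rule converges_small[of _ _ "Suc N"]) auto
    then have "small (int N) ((L2 + L1\<^sup>2 * sum ?h S) * (inverse L1)\<^sup>2)"
      by (intro small_mult_right small_power0 unit)
    also have "(L2 + L1\<^sup>2 * sum ?h S) * (inverse L1)\<^sup>2 = sum ?h S + s"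
      using unit(1) by (simp add: s_def distrib_right divide_inverse power_inverse)
    also have "\<dots> = sum ?h S - s"
      using char2_uminus[OF two', of s] by (simp only: diff_conv_add_uminus)
    finally show ?thesis .
  qed
  have "(?h has_sum s) ?I"
    unfolding has_sum_def
  proof (rule tendstoI)
    fix e :: real assume "e > 0"
    then obtain N where N: "(1 / 2) ^ N < e"
      using real_arch_pow_inv[of e "1 / 2"] by auto
    let ?S = "{P \<in> ?I. degree P \<le> N}"
    have "?S \<subseteq> polys_below (Suc N)"
      by (auto intro: degree_polys_below)
    then have "finite ?S"
      using finite_polys_below finite_subset by blast
    moreover have "dist (sum ?h S) s < e" if "finite S" "?S \<subseteq> S" "S \<subseteq> ?I" for S
    proof -
      have "small (int N) (sum ?h S - s)"
        using that by (intro small_sum_s) auto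
      then show ?thesis
        using dist_le_if_small N by fastforce
    qed
    ultimately show "\<forall>\<^sub>F S in finite_subsets_at_top ?I. dist (sum ?h S) s < e"
      unfolding eventually_finite_subsets_at_top by (intro exI[of _ ?S]) auto
  qed
  then show ?thesis
    using L(4) by (auto simp: s_def has_sum_imp_summable infsumI)
qed

end
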